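(* Let $(X,\mu,T)$, together with the open sets $\{X_i\}_{i\in\mathcal I}$, be a system as described in the context, satisfying the Ahlfors regularity (of dimension $\delta>0$), uniform mixing, bounded distortion, expanding, and conformality conditions listed there. Then for any function $\psi:\mathbb{N}\to\mathbb{R}_+$ (positive values) with $\lim_{n\to\infty}\psi(n)=0$ and any piecewise Lipschitz function $f:X\to X$, the set $$R_T^f(\psi):=\{x\in X: d(T^nx,f(x))<\psi(n)\text{ for infinitely many }n\in\mathbb{N}\}$$ satisfies $\mu\big(R_T^f(\psi)\big)=0$ if and only if the series $\sum_{n=1}^\infty\psi(n)^\delta$ converges.
   Context: $(X,d)$ is a separable compact metric space, $B(x,r)$ denotes the open ball of radius $r$ centered at $x$, and $(X,\mu,T)$ is a probability measure preserving system ($\mu$ a Borel probability measure, $T:X\to X$ measurable and $\mu$-preserving). Cylinders: there are at most countably many pairwise disjoint open subsets $X_i$, $i\in\mathcal I$, of $X$ such that $T|_{X_i}$ is continuous and injective for each $i$ and $\mu(X\setminus\bigcup_iX_i)=0$. For $m\in\mathbb{N}$, $\mathcal F_m:=\{X_{i_1}\cap T^{-1}X_{i_2}\cap\cdots\cap T^{-(m-1)}X_{i_m}: i_1,\dots,i_m\in\mathcal I\}$ (cylinders of order $m$). For $J\in\mathcal F_m$, $K_J:=\inf_{x,y\in J,\,x\ne y}\frac{d(T^mx,T^my)}{d(x,y)}$ (with $\inf\varnothing=+\infty$). Conditions assumed: - Ahlfors regularity of dimension $\delta>0$: there are $\eta_1,\eta_2,r_0>0$ with $\eta_1r^\delta\le\mu(B(x,r))\le\eta_2r^\delta$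 for every ball $B(x,r)\subset X$ with $0<r<r_0$. - Uniform mixing: there is a summable sequence of positive reals $(a_n)_{n\in\mathbb N}$ with $|\mu(E\cap T^{-n}F)-\mu(E)\mu(F)|\le a_n\mu(F)$ for all balls $E,F\subset X$ and all $n\ge1$. - Bounded distortion: there is $K_1>0$ with $K_1^{-1}\le\frac{d(T^mx,T^my)/d(x,y)}{d(T^mx,T^mz)/d(x,z)}\le K_1$ for all $m\in\mathbb N$ and all $x,y,z\in J\in\mathcal F_m$ with $x\ne y$, $x\ne z$. - Expanding: $\inf_{J\in\mathcal F_m}K_J\to\infty$ as $m\to\infty$, and $\sup_{m\in\mathbb N}\sum_{J\in\mathcal F_m}K_J^{-\delta}<\infty$. - Conformality: there is $K_2\ge1$ with $B(T^mx,K_2^{-1}K_Jr)\subset T^mB(x,r)\subset B(T^mx,K_2K_Jr)$ for any $m\in\mathbb N$ and any ball $B(x,r)\subset J\in\mathcal F_m$. A map $g:X\to X$ is Lipschitz if $\sup_{x\neq y}d(g(x),g(y))/d(x,y)<\infty$. A map $f:X\to X$ is piecewise Lipschitz if there are at most countably many measurable subsets $Y_i$ of $X$ and Lipschitz functions $f_i:X\to X$ with $\mu(X\setminus\bigcup_iY_i)=0$ and $f|_{Y_i}=f_i|_{Y_i}$ for each $i$. *)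

theory Defs
  imports "HOL-Probability.Probability"
begin

text \<open>
  The space \<open>X\<close> is the whole type \<open>'a\<close> of class \<open>metric_space\<close>, with compactness as an explicit
  hypothesis. The open sets \<open>X\<^sub>i\<close> are written \<open>P i\<close> for \<open>i \<in> I\<close>.
  Throughout, \<open>\<nat>\<close> is the set of positive integers, hence the guards \<open>m \<ge> 1\<close> and \<open>n \<ge> 1\<close>.
\<close>

definition mpt_system :: "'a::metric_space measure \<Rightarrow> ('a \<Rightarrow> 'a) \<Rightarrow> bool" where
  "mpt_system M T \<longleftrightarrow>
     prob_space M \<and> sets M = sets borel \<and> T \<in> measurable M M \<and> distr M M T = M"

definition open_pieces ::
  "'a::metric_space measure \<Rightarrow> ('a \<Rightarrow> 'a) \<Rightarrow> 'i set \<Rightarrow> ('i \<Rightarrow> 'a set) \<Rightarrow> bool" where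
  "open_pieces M T I P \<longleftrightarrow>
     countable I \<and> disjoint_family_on P I \<and>
     (\<forall>i\<in>I. open (P i) \<and> continuous_on (P i) T \<and> inj_on T (P i)) \<and>
     emeasure M (UNIV - (\<Union>i\<in>I. P i)) = 0"

definition cylinders ::
  "('a \<Rightarrow> 'a) \<Rightarrow> 'i set \<Rightarrow> ('i \<Rightarrow> 'a set) \<Rightarrow> nat \<Rightarrow> 'a set set" where
  "cylinders T I P m = {(\<Inter>k<m. (T ^^ k) -` P (i k)) | i. \<forall>k<m. i k \<in> I}"

text \<open>
  The constant \<open>K\<^sub>J\<close>. The order \<open>m\<close> is an argument because the same set may be a cylinder of several
  orders. The infimum is taken in \<open>ennreal\<close>, so it is \<open>\<infinity>\<close> if \<open>J\<close> has at most one point.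
\<close>

definition expansion :: "('a::metric_space \<Rightarrow> 'a) \<Rightarrow> nat \<Rightarrow> 'a set \<Rightarrow> ennreal" where
  "expansion T m J =
     (INF (x, y) \<in> {(x, y). x \<in> J \<and> y \<in> J \<and> x \<noteq> y}.
        ennreal (dist ((T ^^ m) x) ((T ^^ m) y) / dist x y))"

text \<open>The power \<open>K\<^sup>-\<^sup>\<delta>\<close> for \<open>\<delta> > 0\<close>, with the conventions \<open>0\<^sup>-\<^sup>\<delta> = \<infinity>\<close> and \<open>\<infinity>\<^sup>-\<^sup>\<delta> = 0\<close>.\<close>

definition neg_power :: "ennreal \<Rightarrow> real \<Rightarrow> ennreal" where
  "neg_power K \<delta> =
     (if K = 0 then \<infinity> else if K = \<infinity> then 0 else ennreal (enn2real K powr (- \<delta>)))"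

text \<open>Open balls whose radius may be infinite.\<close>

definition eball :: "'a::metric_space \<Rightarrow> ennreal \<Rightarrow> 'a set" where
  "eball x R = {y. ennreal (dist x y) < R}"

definition ahlfors_regular :: "'a::metric_space measure \<Rightarrow> real \<Rightarrow> bool" where
  "ahlfors_regular M \<delta> \<longleftrightarrow>
     (\<exists>\<eta>\<^sub>1>0. \<exists>\<eta>\<^sub>2>0. \<exists>r\<^sub>0>0. \<forall>x r. 0 < r \<and> r < r\<^sub>0 \<longrightarrow>
        \<eta>\<^sub>1 * r powr \<delta> \<le> measure M (ball x r) \<and> measure M (ball x r) \<le> \<eta>\<^sub>2 * r powr \<delta>)"

definition uniform_mixing :: "'a::metric_space measure \<Rightarrow> ('a \<Rightarrow> 'a) \<Rightarrow> bool" where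
  "uniform_mixing M T \<longleftrightarrow>
     (\<exists>a :: nat \<Rightarrow> real. (\<forall>n\<ge>1. a n > 0) \<and> summable a \<and>
        (\<forall>x r y s n. r > 0 \<and> s > 0 \<and> n \<ge> 1 \<longrightarrow>
           \<bar>measure M (ball x r \<inter> (T ^^ n) -` ball y s) - measure M (ball x r) * measure M (ball y s)\<bar>
             \<le> a n * measure M (ball y s)))"

definition bounded_distortion ::
  "('a::metric_space \<Rightarrow> 'a) \<Rightarrow> 'i set \<Rightarrow> ('i \<Rightarrow> 'a set) \<Rightarrow> bool" where
  "bounded_distortion T I P \<longleftrightarrow>
     (\<exists>K\<^sub>1>0. \<forall>m\<ge>1. \<forall>J\<in>cylinders T I P m. \<forall>x\<in>J. \<forall>y\<in>J. \<forall>z\<in>J. x \<noteq> y \<and> x \<noteq> z \<longrightarrow>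
        (let q = (dist ((T ^^ m) x) ((T ^^ m) y) / dist x y) /
                 (dist ((T ^^ m) x) ((T ^^ m) z) / dist x z)
         in inverse K\<^sub>1 \<le> q \<and> q \<le> K\<^sub>1))"

definition expanding ::
  "('a::metric_space \<Rightarrow> 'a) \<Rightarrow> 'i set \<Rightarrow> ('i \<Rightarrow> 'a set) \<Rightarrow> real \<Rightarrow> bool" where
  "expanding T I P \<delta> \<longleftrightarrow>
     (\<lambda>m. INF J\<in>cylinders T I P m. expansion T m J) \<longlonglongrightarrow> \<infinity> \<and>
     (SUP m\<in>{1..}. \<Sum>\<^sub>\<infinity>J\<in>cylinders T I P m. neg_power (expansion T m J) \<delta>) < \<infinity>"

definition conformal ::
  "('a::metric_space \<Rightarrow> 'a) \<Rightarrow> 'i set \<Rightarrow> ('i \<Rightarrow> 'a set) \<Rightarrow> bool" where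
  "conformal T I P \<longleftrightarrow>
     (\<exists>K\<^sub>2\<ge>1. \<forall>m\<ge>1. \<forall>J\<in>cylinders T I P m. \<forall>x r. r > 0 \<and> ball x r \<subseteq> J \<longrightarrow>
        eball ((T ^^ m) x) (ennreal (inverse K\<^sub>2) * expansion T m J * ennreal r) \<subseteq> (T ^^ m) ` ball x r \<and>
        (T ^^ m) ` ball x r \<subseteq> eball ((T ^^ m) x) (ennreal K\<^sub>2 * expansion T m J * ennreal r))"

definition piecewise_lipschitz :: "'a::metric_space measure \<Rightarrow> ('a \<Rightarrow> 'a) \<Rightarrow> bool" where
  "piecewise_lipschitz M f \<longleftrightarrow>
     (\<exists>(A :: nat set) (Y :: nat \<Rightarrow> 'a set) (g :: nat \<Rightarrow> 'a \<Rightarrow> 'a).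
        (\<forall>i\<in>A. Y i \<in> sets M \<and> (\<exists>L. L-lipschitz_on UNIV (g i)) \<and> (\<forall>x\<in>Y i. f x = g i x)) \<and>
        emeasure M (UNIV - (\<Union>i\<in>A. Y i)) = 0)"

definition recurrence_set :: "('a::metric_space \<Rightarrow> 'a) \<Rightarrow> ('a \<Rightarrow> 'a) \<Rightarrow> (nat \<Rightarrow> real) \<Rightarrow> 'a set" where
  "recurrence_set T f \<psi> = {x. infinite {n. n \<ge> 1 \<and> dist ((T ^^ n) x) (f x) < \<psi> n}}"

text \<open>
  A piecewise Lipschitz \<open>f\<close> is arbitrary on a null set, so \<open>recurrence_set T f \<psi>\<close> need not be Borel,
  only measurable for the completion. Hence \<open>\<mu>(R) = 0\<close> has to be read as
  \<open>R \<in> null_sets (completion M)\<close>; \<open>emeasure M R\<close> would be \<open>0\<close> for every non-Borel \<open>R\<close>.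
\<close>

end

theory Submission
  imports Defs
begin

text \<open>
  On a cylinder \<open>J\<close> of order \<open>m\<close> the map \<open>T\<^sup>m\<close> expands distances by at least \<open>K\<^sub>J\<close>, so for large \<open>m\<close>
  the points of \<open>J\<close> with \<open>d(T\<^sup>m x, f x) < \<psi>(m)\<close> lie in a ball of radius comparable to \<open>\<psi>(m)/K\<^sub>J\<close>.
  Summing over \<open>J\<close> bounds the measure of the hitting set \<open>A\<^sub>m\<close> by a multiple of \<open>\<psi>(m)\<^sup>\<delta>\<close>, and
  Borel-Cantelli settles the convergent case.

  For divergence, \<open>\<mu>(J \<inter> T\<^sup>-\<^sup>mE) \<le> C K\<^sub>J\<^sup>-\<^sup>\<delta> \<mu>(E)\<close> by Ahlfors regularity. Applied to small pieces of
  \<open>J \<inter> A\<^sub>m\<close>, on which \<open>f\<close> is nearly constant, and combined with mixing at time \<open>n - m\<close>, it gives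
  \<open>\<mu>(A\<^sub>m \<inter> A\<^sub>n) \<le> C (\<psi>(m)\<^sup>\<delta> \<psi>(n)\<^sup>\<delta> + a\<^sub>n\<^sub>-\<^sub>m (\<psi>(m)\<^sup>\<delta> + \<psi>(n)\<^sup>\<delta>))\<close>, a global second moment bound. Mixing on
  balls of radius comparable to \<open>\<psi>(n)\<close> gives a lower bound for the measure of \<open>A\<^sub>n\<close> in any open set. The
  Cauchy-Schwarz inequality then shows that the limsup set meets every set of positive measure in
  positive measure.
\<close>

section \<open>Regularity and separated nets\<close>

text \<open>The sets that can be approximated in this way include the closed ones and are stable
  under complements and countable unions, so they exhaust the Borel sets.\<close>

lemma finite_measure_closed_open_approx:
  fixes M :: "'a::metric_space measure"
  assumes fin: "finite_measure M" and sets: "sets M = sets borel"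
    and A: "A \<in> sets borel" and "e > 0"
  shows "\<exists>C U. closed C \<and> open U \<and> C \<subseteq> A \<and> A \<subseteq> U \<and> measure M (U - C) < e"
proof -
  interpret finite_measure M by (rule fin)
  have [measurable_cong]: "sets M = sets borel" by (rule sets)
  have sp: "space M = UNIV" using sets_eq_imp_space_eq[OF sets] by simp
  define \<Phi> where "\<Phi> A \<longleftrightarrow>
    (\<forall>e>0. \<exists>C U. closed C \<and> open U \<and> C \<subseteq> A \<and> A \<subseteq> U \<and> measure M (U - C) < e)" for A
  have cl: "\<Phi> A" if "closed A" for A
    unfolding \<Phi>_def
  proof (intro allI impI)
    fix e :: real assume "e > 0"
    \<comment> \<open>A closed set is the decreasing intersection of its open
      \<open>1 / Suc n\<close>-neighbourhoods, so continuity from above gives the outer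
      approximation.\<close>
    define V where "V n = (\<Union>x\<in>A. ball x (1 / Suc n))" for n
    have V: "open (V n)" "A \<subseteq> V n" for n by (auto simp: V_def)
    have "(\<Inter>n. V n) \<subseteq> A"
    proof
      fix x assume x: "x \<in> (\<Inter>n. V n)"
      have "x \<in> closure A"
        unfolding closure_approachable
      proof (intro allI impI)
        fix d :: real assume "d > 0"
        then obtain n where "1 / Suc n < d" using nat_approx_posE by blast
        moreover obtain y where "y \<in> A" "dist y x < 1 / Suc n"
          using x by (auto simp: V_def)
        ultimately show "\<exists>y\<in>A. dist y x < d" by force
      qed
      then show "x \<in> A" using that by simp
    qed
    then have eq: "(\<Inter>n. V n - A) = {}" by blast
    have "(\<lambda>n. measure M (V n - A)) \<longlonglongrightarrow> measure M (\<Inter>n. V n - A)"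
    proof (rule finite_Lim_measure_decseq)
      show "range (\<lambda>n. V n - A) \<subseteq> sets M"
        using V that by (auto simp: sets)
      show "decseq (\<lambda>n. V n - A)"
        unfolding decseq_Suc_iff
      proof
        fix n
        have "1 / real (Suc (Suc n)) \<le> 1 / Suc n" by (simp add: field_simps)
        then have "ball x (1 / real (Suc (Suc n))) \<subseteq> ball x (1 / Suc n)" for x :: 'a
          by (rule subset_ball)
        then show "V (Suc n) - A \<subseteq> V n - A" unfolding V_def by blast
      qed
    qed
    then have "(\<lambda>n. measure M (V n - A)) \<longlonglongrightarrow> 0" by (simp only: eq measure_empty)
    then have "eventually (\<lambda>n. measure M (V n - A) < e) sequentially"
      using \<open>e > 0\<close> by (rule order_tendstoD)
    then obtain n where "measure M (V n - A) < e" by (auto simp: eventually_sequentially)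
    then show "\<exists>C U. closed C \<and> open U \<and> C \<subseteq> A \<and> A \<subseteq> U \<and> measure M (U - C) < e"
      using V that by blast
  qed
  have "A \<in> sigma_sets UNIV {S. closed S}"
    using A by (simp add: borel_eq_closed)
  then have "\<Phi> A"
  proof induction
    case (Basic a) then show ?case using cl by simp
  next
    case Empty show ?case by (rule cl) simp
  next
    case (Compl a)
    show ?case unfolding \<Phi>_def
    proof (intro allI impI)
      fix e :: real assume "e > 0"
      then obtain C U where *: "closed C" "open U" "C \<subseteq> a" "a \<subseteq> U" "measure M (U - C) < e"
        using Compl.IH[unfolded \<Phi>_def, rule_format, OF \<open>e > 0\<close>] by auto
      have "(UNIV - C) - (UNIV - U) = U - C" by blast
      then show "\<exists>C U. closed C \<and> open U \<and> C \<subseteq> UNIV - a \<and> UNIV - a \<subseteq> U \<and> measure M (U - C) < e"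
        using * by (intro exI[of _ "UNIV - U"] exI[of _ "UNIV - C"]) (auto simp: closed_def Compl_eq_Diff_UNIV)
    qed
  next
    case (Union a)
    show ?case unfolding \<Phi>_def
    proof (intro allI impI)
      fix e :: real assume e: "e > 0"
      \<comment> \<open>These errors sum to \<open>e/2\<close>. The other half pays for cutting the
        infinite union of the \<open>C i\<close> down to a finite one, which is closed.\<close>
      have e': "e/2 * (1/2)^Suc i > 0" for i :: nat using e by simp
      have "\<forall>i. \<exists>C U. closed C \<and> open U \<and> C \<subseteq> a i \<and> a i \<subseteq> U \<and> measure M (U - C) < e/2 * (1/2)^Suc i"
        using Union.IH[unfolded \<Phi>_def, rule_format, OF e'] by blast
      then obtain C U where CU: "\<And>i. closed (C i)" "\<And>i. open (U i)" "\<And>i. C i \<subseteq> a i" "\<And>i. a i \<subseteq> U i"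
        "\<And>i. measure M (U i - C i) < e/2 * (1/2)^Suc i" by metis
      have [measurable]: "C i \<in> sets borel" "U i \<in> sets borel" for i using CU by auto
      define W where "W = (\<Union>i. U i)"
      define D where "D n = (\<Union>i<n. C i)" for n
      have mD: "D n \<in> sets M" and mW: "W \<in> sets M" for n by (auto simp: D_def W_def sets)
      have s: "(\<lambda>i. e/2 * (1/2)^Suc i) sums (e/2)"
        using sums_mult[OF power_half_series, of "e/2"] by simp
      have le: "measure M (U i - C i) \<le> e/2 * (1/2)^Suc i" for i
        using CU(5)[of i] by (rule less_imp_le)
      have sm: "summable (\<lambda>i. measure M (U i - C i))"
        using le by (intro summable_comparison_test'[OF sums_summable[OF s], of 0])
          (simp only: real_norm_def abs_of_nonneg[OF measure_nonneg])
      have "measure M (\<Union>i. U i - C i) \<le> (\<Sum>i. measure M (U i - C i))"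
        using sm by (intro finite_measure_subadditive_countably) (auto simp: sets)
      also have "\<dots> \<le> (\<Sum>i. e/2 * (1/2)^Suc i)"
        by (rule suminf_le[OF le sm sums_summable[OF s]])
      also have "\<dots> = e/2" using s by (rule sums_unique[symmetric])
      finally have 1: "measure M (\<Union>i. U i - C i) \<le> e/2" .
      have "(\<lambda>n. measure M (W - D n)) \<longlonglongrightarrow> measure M (\<Inter>n. W - D n)"
      proof (rule finite_Lim_measure_decseq)
        show "range (\<lambda>n. W - D n) \<subseteq> sets M" using mD mW by auto
        show "decseq (\<lambda>n. W - D n)" by (force simp: decseq_def D_def)
      qed
      moreover have "measure M (\<Inter>n. W - D n) \<le> measure M (\<Union>i. U i - C i)"
        by (rule finite_measure_mono) (auto simp: W_def D_def sets)
      ultimately have "eventually (\<lambda>n. measure M (W - D n) < e) sequentially"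
        using 1 e by (elim order_tendstoD) linarith
      then obtain n where n: "measure M (W - D n) < e" by (auto simp: eventually_sequentially)
      moreover have "closed (D n)" "open W"
        using CU(1,2) by (auto simp: D_def W_def)
      moreover have "D n \<subseteq> (\<Union>i. a i)" "(\<Union>i. a i) \<subseteq> W"
        using CU(3,4) unfolding D_def W_def by blast+
      ultimately show "\<exists>C U. closed C \<and> open U \<and> C \<subseteq> \<Union> (range a) \<and> \<Union> (range a) \<subseteq> U \<and> measure M (U - C) < e"
        by blast
    qed
  qed
  then show ?thesis using \<open>e > 0\<close> unfolding \<Phi>_def by simp
qed

text \<open>The inequality is non-strict so that any point outside the open
  \<open>\<rho>\<close>-balls around \<open>Z\<close> can be added to \<open>Z\<close>.\<close>

definition separated :: "real \<Rightarrow> 'a::metric_space set \<Rightarrow> bool" where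
  "separated \<rho> Z \<longleftrightarrow> (\<forall>x\<in>Z. \<forall>y\<in>Z. x \<noteq> y \<longrightarrow> \<rho> \<le> dist x y)"

lemma separated_disjoint_balls:
  assumes "separated \<rho> Z"
  shows "disjoint_family_on (\<lambda>z. ball z (\<rho>/2)) Z"
proof -
  have "ball x (\<rho>/2) \<inter> ball y (\<rho>/2) = {}" if "x \<in> Z" "y \<in> Z" "x \<noteq> y" for x y
  proof -
    have "\<rho> \<le> dist x y" using assms that by (auto simp: separated_def)
    moreover have "dist x y \<le> dist x u + dist y u" for u by (rule dist_triangle2)
    ultimately show ?thesis by (smt (verit) disjoint_iff field_sum_of_halves mem_ball)
  qed
  then show ?thesis by (auto simp: disjoint_family_on_def)
qed

text \<open>A separated subset of \<open>D\<close> of maximal cardinality is a net, for an uncovered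
  point could be added to it. Total boundedness bounds the cardinalities.\<close>

lemma compact_finite_separated_net:
  fixes D :: "'a::metric_space set"
  assumes "compact (UNIV :: 'a set)" and \<rho>: "\<rho> > 0"
  obtains Z where "finite Z" "Z \<subseteq> D" "separated \<rho> Z" "D \<subseteq> (\<Union>z\<in>Z. ball z \<rho>)"
proof -
  obtain F :: "'a set" where F: "finite F" "UNIV \<subseteq> (\<Union>x\<in>F. ball x (\<rho>/2))"
    using assms(1) \<rho> unfolding compact_eq_totally_bounded by (meson half_gt_zero)
  define Q where "Q Z \<longleftrightarrow> finite Z \<and> Z \<subseteq> D \<and> separated \<rho> Z" for Z
  \<comment> \<open>Two separated points cannot lie in one ball of radius \<open>\<rho>/2\<close>,
    so choosing a centre in \<open>F\<close> is injective.\<close>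
  have card: "card Z \<le> card F" if "Q Z" for Z
  proof -
    have "\<exists>x\<in>F. z \<in> ball x (\<rho>/2)" for z using F by blast
    then obtain h where h: "\<And>z. h z \<in> F" "\<And>z. dist (h z) z < \<rho>/2" by (metis mem_ball)
    have "inj_on h Z"
    proof (rule inj_onI, rule ccontr)
      fix x y assume xy: "x \<in> Z" "y \<in> Z" "h x = h y" "x \<noteq> y"
      then have "dist x y < \<rho>"
        using h(2)[of x] h(2)[of y] dist_triangle3[of x y "h x"] by simp
      moreover have "\<rho> \<le> dist x y" using that xy by (auto simp: Q_def separated_def)
      ultimately show False by simp
    qed
    then show ?thesis using h F by (metis card_inj_on_le image_subset_iff)
  qed
  have "Q {}" by (auto simp: Q_def separated_def)
  then obtain Z where Z: "Q Z" "\<And>Z'. Q Z' \<Longrightarrow> card Z' \<le> card Z"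
    using ex_has_greatest_nat[of Q "{}" card "Suc (card F)"] card by (metis less_Suc_eq_le)
  have "x \<in> (\<Union>z\<in>Z. ball z \<rho>)" if "x \<in> D" for x
  proof (rule ccontr)
    assume n: "x \<notin> (\<Union>z\<in>Z. ball z \<rho>)"
    then have "x \<notin> Z" using \<rho> by auto
    moreover have "Q (insert x Z)"
      using n that Z(1) by (fastforce simp: Q_def separated_def dist_commute not_less)
    ultimately show False using Z(2)[of "insert x Z"] Z(1) by (auto simp: Q_def)
  qed
  then have "D \<subseteq> (\<Union>z\<in>Z. ball z \<rho>)" ..
  then show ?thesis using that[of Z] Z(1) by (auto simp: Q_def)
qed

text \<open>Passing through a countable dense set replaces the distance of two varying points by
  distances to fixed points, and the set becomes a countable union of measurable ones.\<close>

lemma separable_dist_less_measurable: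
  fixes u v :: "'b \<Rightarrow> 'a::metric_space"
  assumes "separable_space (euclidean :: 'a topology)"
    and [measurable]: "u \<in> measurable N borel" "v \<in> measurable N borel"
  shows "{x \<in> space N. dist (u x) (v x) < r} \<in> sets N"
proof -
  obtain D :: "'a set" where D: "countable D" "closure D = UNIV"
    using assms(1) by (auto simp: separable_space_def)
  have [measurable]: "(\<lambda>x. dist x d) \<in> borel_measurable borel" for d :: 'a
    by (intro borel_measurable_continuous_onI continuous_intros)
  have "dist (u x) (v x) < r \<longleftrightarrow> (\<exists>d\<in>D. dist (u x) d + dist (v x) d < r)" for x
  proof
    assume *: "dist (u x) (v x) < r"
    then have "0 < (r - dist (u x) (v x)) / 2" by simp
    then obtain d where "d \<in> D" "dist d (u x) < (r - dist (u x) (v x)) / 2"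
      using D(2) by (metis UNIV_I closure_approachable)
    moreover have "dist (v x) d \<le> dist (u x) (v x) + dist d (u x)"
      by (metis add.commute dist_commute dist_triangle)
    ultimately show "\<exists>d\<in>D. dist (u x) d + dist (v x) d < r"
      by (intro bexI[of _ d]) (simp_all add: dist_commute field_simps)
  next
    assume "\<exists>d\<in>D. dist (u x) d + dist (v x) d < r"
    then show "dist (u x) (v x) < r" by (meson dist_triangle2 le_less_trans)
  qed
  then have "{x \<in> space N. dist (u x) (v x) < r} =
      (\<Union>d\<in>D. {x \<in> space N. dist (u x) d + dist (v x) d < r})" by auto
  also have "\<dots> \<in> sets N"
    using D(1) by (intro sets.countable_UN') auto
  finally show ?thesis .
qed

section \<open>Cylinders and their weights\<close>

lemma finite_sum_le_infsum_ennreal: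
  fixes f :: "'b \<Rightarrow> ennreal"
  assumes "finite F" "F \<subseteq> A"
  shows "sum f F \<le> infsum f A"
  using assms by (subst nonneg_infsum_complete) (auto intro: SUP_upper)

text \<open>Fixes the constants whose existence the hypotheses assert. Bounded distortion appears as
  a one-sided bound with the denominator multiplied out, and \<open>S\<close> bounds the total
  weight of the cylinders of each order.\<close>

locale mixing_expanding_system =
  fixes M :: "'a::metric_space measure" and T :: "'a \<Rightarrow> 'a"
    and I :: "'i set" and P :: "'i \<Rightarrow> 'a set"
    and \<delta> \<eta>1 \<eta>2 r0 K1 S :: real and a :: "nat \<Rightarrow> real"
  assumes compact_UNIV: "compact (UNIV :: 'a set)"
    and separable: "separable_space (euclidean :: 'a topology)"
    and mpt: "mpt_system M T"
    and pieces: "open_pieces M T I P"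
    and \<delta>_pos: "\<delta> > 0" and \<eta>1_pos: "\<eta>1 > 0" and \<eta>2_pos: "\<eta>2 > 0" and r0_pos: "r0 > 0"
    and ball_lower: "\<And>x r. 0 < r \<Longrightarrow> r < r0 \<Longrightarrow> \<eta>1 * r powr \<delta> \<le> measure M (ball x r)"
    and ball_upper: "\<And>x r. 0 < r \<Longrightarrow> r < r0 \<Longrightarrow> measure M (ball x r) \<le> \<eta>2 * r powr \<delta>"
    and a_pos: "\<And>n. n \<ge> 1 \<Longrightarrow> a n > 0" and summable_a: "summable a"
    and mixing: "\<And>x r y s n. r > 0 \<Longrightarrow> s > 0 \<Longrightarrow> n \<ge> 1 \<Longrightarrow>
      \<bar>measure M (ball x r \<inter> (T ^^ n) -` ball y s) - measure M (ball x r) * measure M (ball y s)\<bar>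
             \<le> a n * measure M (ball y s)"
    and K1_ge_1: "K1 \<ge> 1"
    and distortion: "\<And>m J x y z. m \<ge> 1 \<Longrightarrow> J \<in> cylinders T I P m \<Longrightarrow> x \<in> J \<Longrightarrow> y \<in> J \<Longrightarrow> z \<in> J \<Longrightarrow>
      x \<noteq> y \<Longrightarrow> x \<noteq> z \<Longrightarrow>
      dist ((T ^^ m) x) ((T ^^ m) y) / dist x y \<le> K1 * (dist ((T ^^ m) x) ((T ^^ m) z) / dist x z)"
    and expansion_tendsto: "(\<lambda>m. INF J\<in>cylinders T I P m. expansion T m J) \<longlonglongrightarrow> \<infinity>"
    and weight_sum: "\<And>m. m \<ge> 1 \<Longrightarrow>
      (\<Sum>\<^sub>\<infinity>J\<in>cylinders T I P m. neg_power (expansion T m J) \<delta>) \<le> ennreal S"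
    and S_nonneg: "S \<ge> 0"
begin

sublocale prob_space M
  using mpt by (simp add: mpt_system_def)

lemma sets_M [measurable_cong, simp]: "sets M = sets borel"
  using mpt by (simp add: mpt_system_def)

lemma space_M [simp]: "space M = UNIV"
  using sets_eq_imp_space_eq[OF sets_M] by simp

lemma T_measurable [measurable]: "T \<in> measurable borel borel"
  using mpt by (simp add: mpt_system_def cong: measurable_cong_sets)

lemma T_pow_measurable [measurable]: "(T ^^ n) \<in> measurable borel borel"
proof (induction n)
  case (Suc n)
  then have "T \<circ> (T ^^ n) \<in> measurable borel borel"
    by (rule measurable_comp) simp
  then show ?case by simp
qed (simp add: id_def)

lemma vimage_T_pow_borel [intro]: "B \<in> sets borel \<Longrightarrow> (T ^^ n) -` B \<in> sets borel"
  by (rule measurable_sets_borel[OF T_pow_measurable])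

lemma measure_vimage_T_pow: "B \<in> sets borel \<Longrightarrow> measure M ((T ^^ n) -` B) = measure M B"
proof (induction n arbitrary: B)
  case (Suc n)
  have "measure M ((T ^^ Suc n) -` B) = measure M ((T ^^ n) -` (T -` B))"
    by (simp add: vimage_def)
  also have "\<dots> = measure M (T -` B)"
    using measurable_sets[OF T_measurable Suc.prems] by (intro Suc.IH) simp
  also have "\<dots> = measure (distr M M T) B"
    using Suc.prems by (subst measure_distr) (simp_all cong: measurable_cong_sets)
  also have "\<dots> = measure M B" using mpt by (simp add: mpt_system_def)
  finally show ?case .
qed simp

section \<open>Topology and measure of cylinders\<close>

lemma cylinder_Suc:
  assumes "J \<in> cylinders T I P (Suc m)"
  obtains J' i where "J' \<in> cylinders T I P m" "i \<in> I" "J = J' \<inter> (T ^^ m) -` P i"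
proof -
  obtain i where i: "\<forall>k<Suc m. i k \<in> I" "J = (\<Inter>k<Suc m. (T ^^ k) -` P (i k))"
    using assms by (auto simp: cylinders_def)
  have "(\<Inter>k<m. (T ^^ k) -` P (i k)) \<in> cylinders T I P m"
    using i(1) by (auto simp: cylinders_def)
  moreover have "J = (\<Inter>k<m. (T ^^ k) -` P (i k)) \<inter> (T ^^ m) -` P (i m)"
    unfolding i(2) lessThan_Suc by auto
  ultimately show ?thesis using that i(1) by auto
qed

text \<open>The map \<open>T\<close> is continuous only on each piece. The first \<open>m\<close>
  points of an orbit starting in \<open>J\<close> stay in prescribed pieces, so on \<open>J\<close>
  the iterate is a composition of continuous restrictions.\<close>

lemma cylinder_open_continuous:
  "J \<in> cylinders T I P m \<Longrightarrow> open J \<and> continuous_on J (T ^^ m)"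
proof (induction m arbitrary: J)
  case 0
  then show ?case by (auto simp: cylinders_def id_def)
next
  case (Suc m)
  obtain J' i where J: "J' \<in> cylinders T I P m" "i \<in> I" "J = J' \<inter> (T ^^ m) -` P i"
    using cylinder_Suc[OF Suc.prems] .
  have IH: "open J'" "continuous_on J' (T ^^ m)" using Suc.IH[OF J(1)] by auto
  have Pi: "open (P i)" "continuous_on (P i) T" using pieces J(2) by (auto simp: open_pieces_def)
  have "open J" unfolding J(3) by (rule continuous_open_preimage[OF IH(2,1) Pi(1)])
  moreover have "continuous_on J (T \<circ> (T ^^ m))"
  proof (rule continuous_on_compose)
    show "continuous_on J (T ^^ m)" using IH(2) J(3) by (auto intro: continuous_on_subset)
    show "continuous_on ((T ^^ m) ` J) T" using Pi(2) J(3) by (auto intro: continuous_on_subset)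
  qed
  ultimately show ?case by simp
qed

lemma cylinder_borel: "J \<in> cylinders T I P m \<Longrightarrow> J \<in> sets borel"
  using cylinder_open_continuous by auto

lemma countable_cylinders: "countable (cylinders T I P m)"
proof (induction m)
  case 0
  have "cylinders T I P 0 = {UNIV}" by (auto simp: cylinders_def)
  then show ?case by simp
next
  case (Suc m)
  have "cylinders T I P (Suc m) \<subseteq>
      (\<lambda>(J, i). J \<inter> (T ^^ m) -` P i) ` (cylinders T I P m \<times> I)"
    by (rule subsetI) (erule cylinder_Suc, auto)
  moreover have "countable (cylinders T I P m \<times> I)"
    using Suc pieces by (auto simp: open_pieces_def)
  ultimately show ?case by (meson countable_image countable_subset)
qed

text \<open>A point outside every cylinder enters the null set missed by the pieces at some time
  \<open>k < m\<close>, and preimages of null sets are null by invariance.\<close>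

lemma cylinders_cover: "measure M (UNIV - \<Union>(cylinders T I P m)) = 0"
proof -
  define N where "N = UNIV - (\<Union>i\<in>I. P i)"
  have [measurable]: "N \<in> sets borel"
  proof -
    have "open (\<Union>i\<in>I. P i)" using pieces by (auto simp: open_pieces_def)
    then show ?thesis unfolding N_def by auto
  qed
  have N0: "measure M N = 0"
    using pieces by (simp add: N_def open_pieces_def measure_def)
  have "UNIV - \<Union>(cylinders T I P m) \<subseteq> (\<Union>k<m. (T ^^ k) -` N)"
  proof
    fix x assume x: "x \<in> UNIV - \<Union>(cylinders T I P m)"
    show "x \<in> (\<Union>k<m. (T ^^ k) -` N)"
    proof (rule ccontr)
      assume "x \<notin> (\<Union>k<m. (T ^^ k) -` N)"
      then have "\<forall>k. \<exists>i. k < m \<longrightarrow> i \<in> I \<and> (T ^^ k) x \<in> P i" by (auto simp: N_def)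
      then obtain i where "\<And>k. k < m \<Longrightarrow> i k \<in> I \<and> (T ^^ k) x \<in> P (i k)" by metis
      then have "x \<in> \<Union>(cylinders T I P m)"
        unfolding cylinders_def by blast
      then show False using x by auto
    qed
  qed
  then have "measure M (UNIV - \<Union>(cylinders T I P m)) \<le> measure M (\<Union>k<m. (T ^^ k) -` N)"
    by (intro finite_measure_mono) (auto intro!: sets.finite_UN)
  also have "\<dots> \<le> (\<Sum>k<m. measure M ((T ^^ k) -` N))"
    by (intro finite_measure_subadditive_finite) auto
  also have "\<dots> = 0" by (simp add: measure_vimage_T_pow N0)
  finally show ?thesis by (simp add: measure_nonneg antisym)
qed

text \<open>Makes cylinders with at most one point, where \<open>expansion\<close> is infinite,
  negligible.\<close>

lemma measure_singleton: "measure M {x} = 0"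
proof (rule ccontr)
  assume "measure M {x} \<noteq> 0"
  then have pos: "measure M {x} > 0" by (simp add: zero_less_measure_iff)
  \<comment> \<open>With this radius the Ahlfors upper bound is at most half of the mass supposed to
    sit at \<open>x\<close>.\<close>
  define r where "r = min (r0/2) ((measure M {x} / (2 * \<eta>2)) powr (1/\<delta>))"
  have r: "r > 0" "r < r0" using r0_pos pos \<eta>2_pos by (auto simp: r_def)
  have "measure M {x} \<le> measure M (ball x r)" using r by (intro finite_measure_mono) auto
  also have "\<dots> \<le> \<eta>2 * r powr \<delta>" using r by (rule ball_upper)
  also have "\<dots> \<le> \<eta>2 * ((measure M {x} / (2 * \<eta>2)) powr (1/\<delta>)) powr \<delta>"
    using r \<eta>2_pos \<delta>_pos by (intro mult_left_mono powr_mono2) (auto simp: r_def)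
  also have "\<dots> = measure M {x} / 2" using \<delta>_pos \<eta>2_pos pos by (simp add: powr_powr)
  finally show False using pos by simp
qed

text \<open>For a cylinder of order \<open>m \<ge> 1\<close> the conversion to a real loses nothing,
  since the bound on the weight sum makes every single term finite.\<close>

definition weight :: "nat \<Rightarrow> 'a set \<Rightarrow> real" where
  "weight m J = enn2real (neg_power (expansion T m J) \<delta>)"

lemma weight_nonneg: "weight m J \<ge> 0"
  by (simp add: weight_def)

lemma sum_weight_le:
  assumes "m \<ge> 1" "finite F" "F \<subseteq> cylinders T I P m"
  shows "(\<Sum>J\<in>F. weight m J) \<le> S"
proof -
  let ?w = "\<lambda>J. neg_power (expansion T m J) \<delta>"
  have "(\<Sum>J\<in>F. ?w J) \<le> (\<Sum>\<^sub>\<infinity>J\<in>cylinders T I P m. ?w J)"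
    using assms(2,3) by (intro finite_sum_le_infsum_ennreal) auto
  also have "\<dots> \<le> ennreal S" by (rule weight_sum[OF assms(1)])
  finally have le: "(\<Sum>J\<in>F. ?w J) \<le> ennreal S" .
  then have "?w J < top" if "J \<in> F" for J
    using that assms(2) by (meson ennreal_less_top le_less_trans member_le_sum zero_le)
  then have "(\<Sum>J\<in>F. ?w J) = ennreal (\<Sum>J\<in>F. weight m J)"
    by (simp add: weight_def sum_ennreal[symmetric])
  then show ?thesis using le S_nonneg by simp
qed

text \<open>A cylinder with two distinct points has a finite infimum \<open>\<kappa>\<close>, and
  \<open>\<kappa> = 0\<close> would make its weight infinite. The lower estimate is the definition
  of the infimum; the upper one says that by distortion all ratios are comparable to it.\<close>

lemma cylinder_cases:
  assumes m: "m \<ge> 1" and J: "J \<in> cylinders T I P m"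
  obtains "measure M J = 0"
  | \<kappa> where "\<kappa> > 0" "expansion T m J = ennreal \<kappa>" "weight m J = \<kappa> powr - \<delta>"
      "\<And>x y. x \<in> J \<Longrightarrow> y \<in> J \<Longrightarrow> \<kappa> * dist x y \<le> dist ((T ^^ m) x) ((T ^^ m) y)"
      "\<And>x y. x \<in> J \<Longrightarrow> y \<in> J \<Longrightarrow> dist ((T ^^ m) x) ((T ^^ m) y) \<le> K1\<^sup>2 * \<kappa> * dist x y"
proof (cases "\<exists>x y. x \<in> J \<and> y \<in> J \<and> x \<noteq> y")
  case False
  then have "J = {} \<or> (\<exists>x. J = {x})" by blast
  then have "measure M J = 0" using measure_singleton by auto
  then show ?thesis by (rule that(1))
next
  case True
  let ?q = "\<lambda>x y. dist ((T ^^ m) x) ((T ^^ m) y) / dist x y"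
  obtain x0 y0 where xy0: "x0 \<in> J" "y0 \<in> J" "x0 \<noteq> y0" using True by blast
  have le: "expansion T m J \<le> ennreal (?q x y)" if "x \<in> J" "y \<in> J" "x \<noteq> y" for x y
    unfolding expansion_def using that by (intro INF_lower2[of "(x, y)"]) auto
  have "expansion T m J < top" using le[OF xy0] by (rule le_less_trans) simp
  then obtain \<kappa> where \<kappa>: "\<kappa> \<ge> 0" "expansion T m J = ennreal \<kappa>"
    by (cases "expansion T m J") auto
  have "\<kappa> \<noteq> 0"
  proof
    assume "\<kappa> = 0"
    then have "neg_power (expansion T m J) \<delta> = top" using \<kappa> by (simp add: neg_power_def)
    moreover have "(\<Sum>J\<in>{J}. neg_power (expansion T m J) \<delta>) \<le> ennreal S"
      by (rule order_trans[OF finite_sum_le_infsum_ennreal weight_sum[OF m]]) (use J in auto)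
    ultimately show False by (simp add: top_unique)
  qed
  then have pos: "\<kappa> > 0" using \<kappa> by simp
  have low: "\<kappa> * dist x y \<le> dist ((T ^^ m) x) ((T ^^ m) y)" if "x \<in> J" "y \<in> J" for x y
  proof (cases "x = y")
    case False
    then have "\<kappa> \<le> ?q x y" using le[OF that False] \<kappa> by simp
    then show ?thesis using False by (simp add: field_simps)
  qed simp
  have up: "dist ((T ^^ m) x) ((T ^^ m) y) \<le> K1\<^sup>2 * \<kappa> * dist x y" if xy: "x \<in> J" "y \<in> J" for x y
  proof (cases "x = y")
    case False
    \<comment> \<open>Distortion compares pairs with a common point. Going from
      \<open>(x, y)\<close> to \<open>(x, u)\<close> and then to \<open>(u, v)\<close> uses it
      twice, hence the square.\<close>
    have *: "?q x y \<le> K1\<^sup>2 * ?q u v" if uv: "u \<in> J" "v \<in> J" "u \<noteq> v" for u v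
    proof (cases "u = x")
      case True
      have "?q x y \<le> K1 * ?q x v" using m J xy uv False True by (intro distortion) auto
      also have "\<dots> \<le> K1\<^sup>2 * ?q x v"
        using K1_ge_1 by (intro mult_right_mono) (auto simp: power2_eq_square)
      finally show ?thesis using True by simp
    next
      case ne: False
      have "?q x y \<le> K1 * ?q x u" using m J xy uv False ne by (intro distortion) auto
      also have "?q x u = ?q u x" by (simp add: dist_commute)
      also have "K1 * ?q u x \<le> K1 * (K1 * ?q u v)"
        using m J xy uv ne K1_ge_1 by (intro mult_left_mono distortion) auto
      finally show ?thesis by (simp add: power2_eq_square mult.assoc)
    qed
    have "ennreal (?q x y / K1\<^sup>2) \<le> expansion T m J"
      unfolding expansion_def
    proof (rule INF_greatest)
      fix p assume "p \<in> {(x, y). x \<in> J \<and> y \<in> J \<and> x \<noteq> y}"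
      then obtain u v where p: "p = (u, v)" and uv: "u \<in> J" "v \<in> J" "u \<noteq> v" by auto
      from *[OF uv] show "ennreal (?q x y / K1\<^sup>2) \<le> (case p of (u, v) \<Rightarrow> ennreal (?q u v))"
        unfolding p prod.case
        using K1_ge_1 by (intro ennreal_leI, subst pos_divide_le_eq) (simp_all add: mult.commute)
    qed
    then have "?q x y / K1\<^sup>2 \<le> \<kappa>" using \<kappa> by simp
    then have "?q x y \<le> K1\<^sup>2 * \<kappa>"
      using K1_ge_1 by (subst (asm) pos_divide_le_eq) (simp_all add: mult.commute)
    then show ?thesis using False by (simp add: field_simps)
  qed simp
  have "weight m J = \<kappa> powr - \<delta>"
    using pos \<kappa> by (simp add: weight_def neg_power_def)
  then show ?thesis using that(2) pos \<kappa>(2) low up by blast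
qed

text \<open>Turns an estimate on each cylinder into a global one: the cylinders cover almost
  everything and their weights sum to at most \<open>S\<close>.\<close>

lemma measure_le_sum_cylinders:
  assumes m: "m \<ge> 1" and B: "B \<in> sets borel" and c: "c \<ge> 0"
    and le: "\<And>J. J \<in> cylinders T I P m \<Longrightarrow> measure M (J \<inter> B) \<le> c * weight m J"
  shows "measure M B \<le> c * S"
proof -
  let ?F = "cylinders T I P m"
  have ne: "?F \<noteq> {}"
  proof
    assume "?F = {}"
    then have "measure M UNIV = 0" using cylinders_cover[of m] by simp
    then show False using prob_space by simp
  qed
  \<comment> \<open>The enumeration may repeat cylinders. The sums below run over its image sets, so
    no cylinder is counted twice.\<close>
  define e where "e n = from_nat_into ?F n" for n
  have e: "range e = ?F" unfolding e_def using ne countable_cylinders by (rule range_from_nat_into)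
  define U where "U n = (\<Union>J\<in>e ` {..<n}. J \<inter> B)" for n
  have eF: "e k \<in> ?F" for k using e by blast
  have Um: "U n \<in> sets borel" for n
    unfolding U_def using B eF cylinder_borel by auto
  have Ule: "measure M (U n) \<le> c * S" for n
  proof -
    have "measure M (U n) \<le> (\<Sum>J\<in>e ` {..<n}. measure M (J \<inter> B))"
      unfolding U_def using B eF cylinder_borel
      by (intro finite_measure_subadditive_finite) auto
    also have "\<dots> \<le> (\<Sum>J\<in>e ` {..<n}. c * weight m J)"
      using eF le by (intro sum_mono) auto
    also have "\<dots> = c * (\<Sum>J\<in>e ` {..<n}. weight m J)" by (simp add: sum_distrib_left)
    also have "\<dots> \<le> c * S" using m eF c by (intro mult_left_mono sum_weight_le) auto
    finally show ?thesis .
  qed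
  have "(\<lambda>n. measure M (U n)) \<longlonglongrightarrow> measure M (\<Union>n. U n)"
    using Um by (intro finite_Lim_measure_incseq) (auto simp: incseq_def U_def Bex_def intro: less_le_trans)
  then have 1: "measure M (\<Union>n. U n) \<le> c * S"
    by (rule LIMSEQ_le_const2) (use Ule in auto)
  have eqU: "(\<Union>n. U n) = \<Union>?F \<inter> B"
    unfolding e[symmetric] U_def by auto
  have FB: "\<Union>?F \<in> sets borel"
    using countable_cylinders cylinder_borel by (intro sets.countable_Union) auto
  have "measure M B \<le> measure M ((\<Union>?F \<inter> B) \<union> (UNIV - \<Union>?F))"
    using B FB by (intro finite_measure_mono) auto
  also have "\<dots> \<le> measure M (\<Union>?F \<inter> B) + measure M (UNIV - \<Union>?F)"
    using B FB by (intro measure_Un_le) auto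
  finally show ?thesis using 1 eqU cylinders_cover by simp
qed

end

section \<open>Hitting sets inside a cylinder\<close>

text \<open>The arithmetic of \<open>measure_cylinder_hit_hit_le\<close>, where about
  \<open>(s/\<rho>) powr \<delta>\<close> pieces of radius \<open>\<rho>\<close> occur. The product
  \<open>(s/\<rho>) * (K * \<kappa> * \<rho>)\<close> is \<open>4 * K * p\<close> for every
  \<open>\<rho>\<close>, and \<open>(s/\<rho>) * q\<close> is the maximum of \<open>s\<close> and
  \<open>q\<close>.\<close>

lemma powr_min_split:
  fixes s q p \<kappa> K \<delta> \<eta> b :: real
  assumes pos: "s > 0" "q > 0" "p > 0" "\<kappa> > 0" "K > 0" "\<delta> > 0" "\<eta> \<ge> 0" "b \<ge> 0"
    and s: "\<kappa> * s = 4 * p" "s \<le> 4 * p"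
  defines "\<rho> \<equiv> min s q"
  shows "(s/\<rho>) powr \<delta> * (\<eta> * (K * \<kappa> * \<rho>) powr \<delta> + b) * q powr \<delta> \<le>
    4 powr \<delta> * (1 + \<eta> * K powr \<delta>) * (p powr \<delta> * q powr \<delta> + b * (p powr \<delta> + q powr \<delta>))"
proof -
  define P Q F H where "P = p powr \<delta>" and "Q = q powr \<delta>" and "F = (4::real) powr \<delta>"
    and "H = \<eta> * K powr \<delta>"
  have nn: "P \<ge> 0" "Q \<ge> 0" "H \<ge> 0" using pos by (auto simp: P_def Q_def H_def)
  have F: "F \<ge> 1" using pos by (simp add: F_def ge_one_powr_ge_zero)
  have \<rho>: "\<rho> > 0" using pos by (simp add: \<rho>_def)
  have "(s/\<rho>) powr \<delta> * (K * \<kappa> * \<rho>) powr \<delta> = ((s/\<rho>) * (K * \<kappa> * \<rho>)) powr \<delta>"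
    using pos \<rho> by (subst powr_mult) auto
  also have "(s/\<rho>) * (K * \<kappa> * \<rho>) = K * (\<kappa> * s)" using \<rho> by simp
  also have "\<dots> = K * (4 * p)" by (simp only: s)
  also have "\<dots> powr \<delta> = K powr \<delta> * (F * P)"
    using pos by (simp add: powr_mult F_def P_def)
  finally have e1: "(s/\<rho>) powr \<delta> * (K * \<kappa> * \<rho>) powr \<delta> = K powr \<delta> * (F * P)" .
  have "(s/\<rho>) powr \<delta> * Q = ((s/\<rho>) * q) powr \<delta>"
    using pos \<rho> unfolding Q_def by (subst powr_mult) auto
  also have "(s/\<rho>) * q = max s q"
    using pos by (auto simp: \<rho>_def min_def max_def)
  also have "max s q powr \<delta> \<le> s powr \<delta> + Q" by (auto simp: max_def Q_def)
  also have "s powr \<delta> \<le> (4 * p) powr \<delta>" using s pos by (intro powr_mono2) auto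
  also have "(4 * p) powr \<delta> = F * P" using pos by (simp add: powr_mult F_def P_def)
  also have "F * P + Q \<le> F * (P + Q)"
    using mult_right_mono[OF F, of Q] nn by (simp add: algebra_simps)
  finally have "(s/\<rho>) powr \<delta> * Q \<le> F * (P + Q)" by simp
  then have e2: "b * ((s/\<rho>) powr \<delta> * Q) \<le> b * (F * (P + Q))"
    using pos by (intro mult_left_mono) auto
  have "(s/\<rho>) powr \<delta> * (\<eta> * (K * \<kappa> * \<rho>) powr \<delta> + b) * Q =
      \<eta> * ((s/\<rho>) powr \<delta> * (K * \<kappa> * \<rho>) powr \<delta>) * Q + b * ((s/\<rho>) powr \<delta> * Q)"
    by (simp only: distrib_left distrib_right mult_ac)
  also have "\<dots> \<le> F * H * (P * Q) + b * (F * (P + Q))"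
    using e2 unfolding e1 H_def by (simp only: mult_ac add_le_cancel_left)
  \<comment> \<open>The added nonnegative terms let the sum factor.\<close>
  also have "\<dots> \<le> F * H * (P * Q) + b * (F * (P + Q)) + (F * (P * Q) + b * (F * (P + Q)) * H)"
    using nn pos F by simp
  also have "\<dots> = F * (1 + H) * (P * Q + b * (P + Q))"
    by (simp add: algebra_simps)
  finally show ?thesis unfolding P_def Q_def F_def H_def .
qed

context mixing_expanding_system
begin

lemma card_separated_le:
  assumes "finite Z" "separated \<rho> Z" "0 < \<rho>" "\<rho> < 2 * r0"
    and "(\<Union>z\<in>Z. ball z (\<rho>/2)) \<subseteq> U" "U \<in> sets borel"
  shows "real (card Z) * (\<eta>1 * (\<rho>/2) powr \<delta>) \<le> measure M U"
proof -
  have "real (card Z) * (\<eta>1 * (\<rho>/2) powr \<delta>) = (\<Sum>z\<in>Z. \<eta>1 * (\<rho>/2) powr \<delta>)" by simp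
  also have "\<dots> \<le> (\<Sum>z\<in>Z. measure M (ball z (\<rho>/2)))"
    using assms by (intro sum_mono ball_lower) auto
  also have "\<dots> = measure M (\<Union>z\<in>Z. ball z (\<rho>/2))"
    using assms by (intro finite_measure_finite_Union[symmetric] separated_disjoint_balls) auto
  also have "\<dots> \<le> measure M U" using assms by (intro finite_measure_mono) auto
  finally show ?thesis .
qed

text \<open>The centres are \<open>h z\<close> so that a net of an image set can be pulled back
  through chosen preimages.\<close>

lemma measure_le_card_net:
  assumes "finite Z" "0 < r" "r < r0" "D \<subseteq> (\<Union>z\<in>Z. ball (h z) r)"
  shows "measure M D \<le> real (card Z) * (\<eta>2 * r powr \<delta>)"
proof -
  have "measure M D \<le> measure M (\<Union>z\<in>Z. ball (h z) r)"
    using assms by (intro finite_measure_mono) auto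
  also have "\<dots> \<le> (\<Sum>z\<in>Z. measure M (ball (h z) r))"
    using assms by (intro finite_measure_subadditive_finite) auto
  also have "\<dots> \<le> (\<Sum>z\<in>Z. \<eta>2 * r powr \<delta>)" using assms by (intro sum_mono ball_upper) auto
  finally show ?thesis by simp
qed

lemma approx_open_closed:
  assumes "E \<in> sets borel" "e > 0"
  obtains C U where "closed C" "open U" "C \<subseteq> E" "E \<subseteq> U"
    "measure M U \<le> measure M E + e" "measure M E \<le> measure M C + e" "measure M (U - C) < e"
proof -
  obtain C U where *: "closed C" "open U" "C \<subseteq> E" "E \<subseteq> U" "measure M (U - C) < e"
    using finite_measure_closed_open_approx[OF finite_measure_axioms sets_M assms] by blast
  have [simp]: "C \<in> sets borel" "U \<in> sets borel" using * by auto
  have eq: "measure M (U - C) = measure M U - measure M C"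
    using * by (intro finite_measure_Diff) auto
  have "measure M C \<le> measure M E" "measure M E \<le> measure M U"
    using * assms by (auto intro!: finite_measure_mono)
  then show ?thesis using that[of C U] * eq by linarith
qed

text \<open>The inverse branch on \<open>J\<close> contracts distances by \<open>K\<^sub>J\<close>, so it carries a net of
  \<open>T\<^sup>m K\<close> to a net of \<open>K\<close>, and Ahlfors regularity turns cardinalities of nets into measures.\<close>

lemma measure_cylinder_vimage_le:
  assumes m: "m \<ge> 1" and J: "J \<in> cylinders T I P m" and E: "E \<in> sets borel"
  shows "measure M (J \<inter> (T ^^ m) -` E) \<le> \<eta>2 / \<eta>1 * 2 powr \<delta> * weight m J * measure M E"
    (is "_ \<le> ?c * _")
  using m J
proof (cases rule: cylinder_cases)
  case 1
  have "measure M (J \<inter> (T ^^ m) -` E) \<le> measure M J"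
    using cylinder_borel[OF J] by (intro finite_measure_mono) auto
  also have "\<dots> \<le> ?c * measure M E" using 1 \<eta>1_pos \<eta>2_pos weight_nonneg by simp
  finally show ?thesis .
next
  case (2 \<kappa>)
  have c: "?c \<ge> 0" using \<eta>1_pos \<eta>2_pos weight_nonneg by simp
  have *: "measure M (J \<inter> (T ^^ m) -` E) \<le> ?c * measure M E + (?c + 1) * e" if e: "e > 0" for e
  proof -
    obtain U where U: "open U" "E \<subseteq> U" "measure M U \<le> measure M E + e"
      using approx_open_closed[OF E e] by metis
    define G where "G = J \<inter> (T ^^ m) -` U"
    have oc: "open J" "continuous_on J (T ^^ m)" using cylinder_open_continuous[OF J] by auto
    have G: "open G" unfolding G_def by (rule continuous_open_preimage[OF oc(2,1) U(1)])
    \<comment> \<open>Compactness of \<open>K\<close> gives its image a uniform neighbourhood inside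
      \<open>U\<close>, which will contain the disjoint balls around the net.\<close>
    obtain K where K: "closed K" "K \<subseteq> G" "measure M G \<le> measure M K + e"
      using approx_open_closed[of G e] G e by (metis borel_open)
    have "compact K" using compact_UNIV K(1) by (metis compact_Int_closed inf_top_left)
    moreover have "continuous_on K (T ^^ m)"
      using oc(2) K(2) by (auto simp: G_def intro: continuous_on_subset)
    ultimately have "compact ((T ^^ m) ` K)" by (intro compact_continuous_image)
    moreover have "(T ^^ m) ` K \<subseteq> U" using K(2) by (auto simp: G_def)
    ultimately obtain t where t: "t > 0" "(\<Union>x\<in>(T ^^ m) ` K. ball x t) \<subseteq> U"
      using compact_subset_open_imp_ball_epsilon_subset U(1) by metis
    \<comment> \<open>The bound \<open>t\<close> keeps the balls in \<open>U\<close>; the other two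
      keep both \<open>\<rho>\<close> and \<open>\<rho>/\<kappa>\<close> in the range of Ahlfors
      regularity.\<close>
    define \<rho> where "\<rho> = min t (min (r0/2) (\<kappa> * r0/2))"
    have \<rho>: "\<rho> > 0" "\<rho> \<le> t" "\<rho> < r0" "\<rho> \<le> \<kappa> * r0/2" using t r0_pos 2(1) by (auto simp: \<rho>_def)
    obtain Z where Z: "finite Z" "Z \<subseteq> (T ^^ m) ` K" "separated \<rho> Z"
      "(T ^^ m) ` K \<subseteq> (\<Union>z\<in>Z. ball z \<rho>)"
      using compact_finite_separated_net[OF compact_UNIV \<rho>(1)] .
    have "\<forall>z\<in>Z. \<exists>x. x \<in> K \<and> (T ^^ m) x = z" using Z(2) by blast
    then obtain h where h: "\<And>z. z \<in> Z \<Longrightarrow> h z \<in> K" "\<And>z. z \<in> Z \<Longrightarrow> (T ^^ m) (h z) = z" by metis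
    have "K \<subseteq> (\<Union>z\<in>Z. ball (h z) (\<rho>/\<kappa>))"
    proof
      fix x assume x: "x \<in> K"
      then obtain z where z: "z \<in> Z" "dist z ((T ^^ m) x) < \<rho>" using Z(4) by fastforce
      have "\<kappa> * dist (h z) x \<le> dist ((T ^^ m) (h z)) ((T ^^ m) x)"
        using x h(1)[OF z(1)] K(2) by (intro 2) (auto simp: G_def)
      also have "\<dots> < \<rho>" using z h(2) by simp
      finally have "dist (h z) x < \<rho>/\<kappa>" using 2(1) by (simp add: field_simps)
      then show "x \<in> (\<Union>z\<in>Z. ball (h z) (\<rho>/\<kappa>))" using z(1) by auto
    qed
    moreover have "\<rho>/\<kappa> < r0"
    proof -
      have "\<rho>/\<kappa> \<le> r0/2" using \<rho>(4) 2(1) by (simp add: field_simps)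
      then show ?thesis using r0_pos by linarith
    qed
    ultimately have "measure M K \<le> real (card Z) * (\<eta>2 * (\<rho>/\<kappa>) powr \<delta>)"
      using Z(1) \<rho>(1) 2(1) by (intro measure_le_card_net[where h = h]) auto
    also have "(\<rho>/\<kappa>) powr \<delta> = 2 powr \<delta> * \<kappa> powr - \<delta> * (\<rho>/2) powr \<delta>"
      using 2(1) \<rho>(1) by (simp add: powr_divide powr_minus field_simps)
    also have "real (card Z) * (\<eta>2 * (2 powr \<delta> * \<kappa> powr - \<delta> * (\<rho>/2) powr \<delta>)) =
        ?c * (real (card Z) * (\<eta>1 * (\<rho>/2) powr \<delta>))"
      using 2(3) \<eta>1_pos by simp
    also have "\<dots> \<le> ?c * measure M U"
    proof (rule mult_left_mono[OF card_separated_le c])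
      show "(\<Union>z\<in>Z. ball z (\<rho>/2)) \<subseteq> U"
      proof -
        have *: "ball z t \<subseteq> U" if "z \<in> (T ^^ m) ` K" for z
          using t(2) that by (simp only: UN_subset_iff)
        have "ball z (\<rho>/2) \<subseteq> U" if "z \<in> Z" for z
        proof -
          have "ball z (\<rho>/2) \<subseteq> ball z t" using \<rho> by (intro subset_ball) auto
          then show ?thesis using *[OF subsetD[OF Z(2) that]] by (rule order_trans)
        qed
        then show ?thesis by (rule UN_least)
      qed
    qed (use Z \<rho> U(1) r0_pos in auto)
    also have "\<dots> \<le> ?c * (measure M E + e)" using U(3) c by (rule mult_left_mono)
    finally have "measure M G \<le> ?c * (measure M E + e) + e" using K(3) by simp
    moreover have "measure M (J \<inter> (T ^^ m) -` E) \<le> measure M G"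
      using G U(2) by (intro finite_measure_mono) (auto simp: G_def)
    ultimately have "measure M (J \<inter> (T ^^ m) -` E) \<le> ?c * (measure M E + e) + e"
      by (rule order_trans[rotated])
    then show ?thesis by (simp only: distrib_left distrib_right mult_1_left add.assoc)
  qed
  show ?thesis
  proof (rule field_le_epsilon)
    fix e :: real assume "e > 0"
    then have "e / (?c + 1) > 0" using c by simp
    from *[OF this] show "measure M (J \<inter> (T ^^ m) -` E) \<le> ?c * measure M E + e"
      using c by (simp add: divide_simps split: if_splits)
  qed
qed

definition hit :: "('a \<Rightarrow> 'a) \<Rightarrow> nat \<Rightarrow> real \<Rightarrow> 'a set" where
  "hit g n r = {x. dist ((T ^^ n) x) (g x) < r}"

lemma hit_borel:
  assumes "L-lipschitz_on UNIV g"
  shows "hit g n r \<in> sets borel"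
proof -
  have "g \<in> measurable borel borel"
    using assms by (intro borel_measurable_continuous_onI) (rule lipschitz_on_continuous_on)
  from separable_dist_less_measurable[OF separable T_pow_measurable this, of n r]
  show ?thesis by (simp add: hit_def)
qed

text \<open>On \<open>J\<close> the iterate expands at least twice as fast as \<open>g\<close> can
  move, so the Lipschitz term is absorbed into half of the left-hand side.\<close>

lemma hit_cylinder_diameter:
  assumes low: "\<And>x y. x \<in> J \<Longrightarrow> y \<in> J \<Longrightarrow> \<kappa> * dist x y \<le> dist ((T ^^ m) x) ((T ^^ m) y)"
    and L: "L-lipschitz_on UNIV g" "2 * L \<le> \<kappa>"
    and xy: "x \<in> J \<inter> hit g m p" "y \<in> J \<inter> hit g m p"
  shows "\<kappa> * dist x y \<le> 4 * p"
proof -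
  have "\<kappa> * dist x y \<le> dist ((T ^^ m) x) ((T ^^ m) y)" using low xy by auto
  also have "\<dots> \<le> dist ((T ^^ m) x) (g x) + dist (g x) (g y) + dist ((T ^^ m) y) (g y)"
    using dist_triangle[of "(T ^^ m) x" "(T ^^ m) y" "g x"]
      dist_triangle[of "g x" "(T ^^ m) y" "g y"] by (simp add: dist_commute)
  also have "\<dots> \<le> 2 * p + L * dist x y"
    using xy lipschitz_onD[OF L(1), of x y] by (simp add: hit_def)
  also have "2 * (L * dist x y) \<le> \<kappa> * dist x y"
    using mult_right_mono[OF L(2), of "dist x y"] by simp
  then have "2 * p + L * dist x y \<le> 2 * p + \<kappa> * dist x y / 2" by simp
  finally show ?thesis by simp
qed

lemma measure_cylinder_hit_le:
  assumes m: "m \<ge> 1" and J: "J \<in> cylinders T I P m"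
    and L: "L-lipschitz_on UNIV g" "L \<ge> 1" "ennreal (2 * L) \<le> expansion T m J"
    and p: "0 < p" "8 * p < r0"
  shows "measure M (J \<inter> hit g m p) \<le> \<eta>2 * 8 powr \<delta> * p powr \<delta> * weight m J"
  using m J
proof (cases rule: cylinder_cases)
  case 1
  have "measure M (J \<inter> hit g m p) \<le> measure M J"
    using cylinder_borel[OF J] by (intro finite_measure_mono) auto
  also have "\<dots> \<le> \<eta>2 * 8 powr \<delta> * p powr \<delta> * weight m J"
    using 1 \<eta>2_pos weight_nonneg by simp
  finally show ?thesis .
next
  case (2 \<kappa>)
  have \<kappa>: "2 * L \<le> \<kappa>" using L(3) 2(1) unfolding 2(2) by simp
  show ?thesis
  proof (cases "J \<inter> hit g m p = {}")
    case True
    then show ?thesis using \<eta>2_pos weight_nonneg by simp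
  next
    case False
    then obtain x where x: "x \<in> J \<inter> hit g m p" by blast
    \<comment> \<open>The diameter bound is \<open>4 * p / \<kappa>\<close>; doubling it gives the
      strict inequality that an open ball requires.\<close>
    have "J \<inter> hit g m p \<subseteq> ball x (8 * p / \<kappa>)"
    proof
      fix y assume "y \<in> J \<inter> hit g m p"
      then have "\<kappa> * dist x y \<le> 4 * p" using hit_cylinder_diameter[OF 2(4) L(1) \<kappa> x] by blast
      then have "dist x y * \<kappa> < 8 * p" using p by (simp add: mult.commute)
      then show "y \<in> ball x (8 * p / \<kappa>)" using 2(1) by (simp add: pos_less_divide_eq)
    qed
    then have "measure M (J \<inter> hit g m p) \<le> measure M (ball x (8 * p / \<kappa>))"
      by (intro finite_measure_mono) auto
    also have "\<dots> \<le> \<eta>2 * (8 * p / \<kappa>) powr \<delta>"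
    proof (rule ball_upper)
      have "8 * p / \<kappa> \<le> 8 * p" using \<kappa> L(2) p by (simp add: pos_divide_le_eq 2(1))
      then show "8 * p / \<kappa> < r0" using p by simp
    qed (use p 2(1) in simp)
    also have "\<dots> = \<eta>2 * 8 powr \<delta> * p powr \<delta> * weight m J"
      using 2(1,3) p by (simp add: powr_divide powr_mult powr_minus field_simps)
    finally show ?thesis .
  qed
qed

text \<open>The factors are, in order: the count of pieces, the bound for preimages in a cylinder,
  the measure of a target ball up to \<open>q powr \<delta>\<close>, and the constant of
  \<open>powr_min_split\<close>.\<close>

definition pair_const :: "real \<Rightarrow> real" where
  "pair_const L = \<eta>2 / \<eta>1 * 4 powr \<delta> * (\<eta>2 / \<eta>1 * 2 powr \<delta>) * (\<eta>2 * (2 * L) powr \<delta>) *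
     (4 powr \<delta> * (1 + \<eta>2 * (K1\<^sup>2) powr \<delta>))"

lemma pair_const_pos: "L \<ge> 1 \<Longrightarrow> pair_const L > 0"
  using \<eta>1_pos \<eta>2_pos K1_ge_1 unfolding pair_const_def
  by (intro mult_pos_pos divide_pos_pos add_pos_nonneg) auto

text \<open>On a piece of radius at most \<open>q\<close> the target \<open>g x\<close> may be
  frozen at \<open>g z\<close> if the radius grows to \<open>2 * L * q\<close>. Then
  \<open>T ^^ m\<close> sends the piece into one ball and time \<open>k\<close> only concerns a
  fixed ball, the form that mixing requires.\<close>

lemma hit_cylinder_piece_subset:
  assumes L: "L-lipschitz_on UNIV g" "L \<ge> 1"
    and up: "\<And>x y. x \<in> J \<Longrightarrow> y \<in> J \<Longrightarrow> dist ((T ^^ m) x) ((T ^^ m) y) \<le> K * dist x y"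
    and K: "K > 0" and \<rho>: "\<rho> \<le> q" and z: "z \<in> J"
  shows "J \<inter> hit g (m + k) q \<inter> ball z \<rho> \<subseteq>
    J \<inter> (T ^^ m) -` (ball ((T ^^ m) z) (K * \<rho>) \<inter> (T ^^ k) -` ball (g z) (2 * L * q))"
proof
  fix x assume x: "x \<in> J \<inter> hit g (m + k) q \<inter> ball z \<rho>"
  then have d: "dist z x < \<rho>" by simp
  have "dist ((T ^^ m) z) ((T ^^ m) x) \<le> K * dist z x" using x z by (intro up) auto
  also have "\<dots> < K * \<rho>" using d K by simp
  finally have 1: "dist ((T ^^ m) z) ((T ^^ m) x) < K * \<rho>" .
  have q: "q > 0" using \<rho> d zero_le_dist[of z x] by linarith
  have eq: "(T ^^ (m + k)) x = (T ^^ k) ((T ^^ m) x)" by (subst add.commute) (simp add: funpow_add)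
  have "dist (g z) ((T ^^ k) ((T ^^ m) x)) \<le> dist (g z) (g x) + dist (g x) ((T ^^ (m + k)) x)"
    unfolding eq by (rule dist_triangle)
  also have "dist (g x) ((T ^^ (m + k)) x) < q" using x by (simp add: hit_def dist_commute)
  also have "dist (g z) (g x) \<le> L * dist z x" using lipschitz_onD[OF L(1)] by simp
  also have "L * dist z x \<le> L * q" using d \<rho> L(2) by (intro mult_left_mono) auto
  also have "L * q + q \<le> 2 * L * q" using mult_right_mono[OF L(2), of q] q by simp
  finally have "dist (g z) ((T ^^ k) ((T ^^ m) x)) < 2 * L * q" by simp
  then show "x \<in> J \<inter> (T ^^ m) -` (ball ((T ^^ m) z) (K * \<rho>) \<inter> (T ^^ k) -` ball (g z) (2 * L * q))"
    using 1 x by simp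
qed

text \<open>The hit at time \<open>m\<close> confines the set to diameter
  \<open>4 * p / \<kappa>\<close>. It is cut into small pieces, their number is bounded by
  regularity, and each is transported by \<open>T ^^ m\<close> to a ball where mixing over the
  remaining time \<open>k\<close> applies.\<close>

lemma measure_cylinder_hit_hit_le:
  assumes m: "m \<ge> 1" and k: "k \<ge> 1" and J: "J \<in> cylinders T I P m"
    and L: "L-lipschitz_on UNIV g" "L \<ge> 1" "ennreal (2 * L) \<le> expansion T m J"
    and p: "0 < p" "8 * p < r0" "4 * K1\<^sup>2 * p < r0"
    and q: "0 < q" "2 * L * q < r0"
  shows "measure M (J \<inter> (hit g m p \<inter> hit g (m + k) q)) \<le>
    pair_const L * (p powr \<delta> * q powr \<delta> + a k * (p powr \<delta> + q powr \<delta>)) * weight m J"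
    (is "_ \<le> ?rhs")
  using m J
proof (cases rule: cylinder_cases)
  have rhs: "?rhs \<ge> 0"
    using pair_const_pos[OF L(2)] weight_nonneg a_pos[OF k] by (simp add: less_imp_le)
  {
    case 1
    have "measure M (J \<inter> (hit g m p \<inter> hit g (m + k) q)) \<le> measure M J"
      using cylinder_borel[OF J] by (intro finite_measure_mono) auto
    then show ?thesis using 1 rhs by simp
  next
    case (2 \<kappa>)
    have \<kappa>: "2 * L \<le> \<kappa>" using L(3) 2(1) unfolding 2(2) by simp
    let ?D = "J \<inter> (hit g m p \<inter> hit g (m + k) q)"
    show ?thesis
    proof (cases "?D = {}")
      case True
      show ?thesis unfolding True using rhs by simp
    next
      case False
      then obtain x1 where x1: "x1 \<in> ?D" by blast
      define s where "s = 4 * p / \<kappa>"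
      have s: "s > 0" "\<kappa> * s = 4 * p" using 2(1) p(1) by (auto simp: s_def)
      have s4: "s \<le> 4 * p" using \<kappa> L(2) p unfolding s_def by (simp add: pos_divide_le_eq 2(1))
      have diam: "dist x y \<le> s" if "x \<in> ?D" "y \<in> ?D" for x y
      proof -
        have "\<kappa> * dist x y \<le> \<kappa> * s"
          using hit_cylinder_diameter[OF 2(4) L(1) \<kappa>, where x = x and y = y and p = p] that s(2) by auto
        then show ?thesis using 2(1) by simp
      qed
      \<comment> \<open>The bound \<open>q\<close> allows the target to be frozen. The bound
        \<open>s\<close> keeps the image radius \<open>R\<close> below \<open>r0\<close> and keeps
        the half-radius balls of the net inside \<open>ball x1 (2 * s)\<close>.\<close>
      define \<rho> where "\<rho> = min s q"
      have \<rho>: "\<rho> > 0" "\<rho> \<le> s" "\<rho> \<le> q" using s q by (auto simp: \<rho>_def)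
      obtain Z where Z: "finite Z" "Z \<subseteq> ?D" "separated \<rho> Z" "?D \<subseteq> (\<Union>z\<in>Z. ball z \<rho>)"
        using compact_finite_separated_net[OF compact_UNIV \<rho>(1)] .
      have cardZ: "real (card Z) \<le> \<eta>2 / \<eta>1 * 4 powr \<delta> * (s/\<rho>) powr \<delta>"
      proof -
        have "real (card Z) * (\<eta>1 * (\<rho>/2) powr \<delta>) \<le> measure M (ball x1 (2 * s))"
        proof (rule card_separated_le)
          show "(\<Union>z\<in>Z. ball z (\<rho>/2)) \<subseteq> ball x1 (2 * s)"
          proof
            fix y assume "y \<in> (\<Union>z\<in>Z. ball z (\<rho>/2))"
            then obtain z where z: "z \<in> Z" "dist z y < \<rho>/2" by auto
            have "dist x1 y \<le> dist x1 z + dist z y" by (rule dist_triangle)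
            also have "dist x1 z \<le> s" using diam x1 z(1) Z(2) by blast
            finally show "y \<in> ball x1 (2 * s)" using z(2) \<rho> by simp
          qed
        qed (use Z \<rho> s4 p r0_pos in auto)
        also have "\<dots> \<le> \<eta>2 * (2 * s) powr \<delta>" using s s4 p by (intro ball_upper) auto
        also have "(2 * s) powr \<delta> = 4 powr \<delta> * (s/\<rho>) powr \<delta> * (\<rho>/2) powr \<delta>"
        proof -
          have "2 * s = 4 * (s/\<rho>) * (\<rho>/2)" using \<rho> by simp
          then show ?thesis using s \<rho> by (simp only: powr_mult)
        qed
        finally have "(real (card Z) * \<eta>1) * (\<rho>/2) powr \<delta> \<le>
            (\<eta>2 * 4 powr \<delta> * (s/\<rho>) powr \<delta>) * (\<rho>/2) powr \<delta>" by (simp only: mult.assoc)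
        then have "real (card Z) * \<eta>1 \<le> \<eta>2 * 4 powr \<delta> * (s/\<rho>) powr \<delta>" using \<rho> by simp
        then show ?thesis using \<eta>1_pos by (simp add: field_simps)
      qed
      define R where "R = K1\<^sup>2 * \<kappa> * \<rho>"
      have K: "K1\<^sup>2 * \<kappa> > 0" using K1_ge_1 2(1) by simp
      have R: "R > 0" "R < r0"
      proof -
        show "R > 0" using K1_ge_1 2(1) \<rho>(1) by (simp add: R_def)
        have "K1\<^sup>2 * \<kappa> * \<rho> \<le> K1\<^sup>2 * \<kappa> * s" using \<rho> K1_ge_1 2(1) by (intro mult_left_mono) auto
        also have "\<dots> = 4 * K1\<^sup>2 * p" using s(2) by (simp add: mult.assoc)
        finally show "R < r0" using p unfolding R_def by simp
      qed
      define Q where "Q = \<eta>2 * (2 * L * q) powr \<delta>"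
      have Q: "Q \<ge> 0" using \<eta>2_pos by (simp add: Q_def)
      define c where "c = \<eta>2 / \<eta>1 * 2 powr \<delta> * weight m J"
      have c: "c \<ge> 0" using \<eta>1_pos \<eta>2_pos weight_nonneg by (simp add: c_def)
      have piece: "measure M (?D \<inter> ball z \<rho>) \<le> c * ((\<eta>2 * R powr \<delta> + a k) * Q)" if z: "z \<in> Z" for z
      proof -
        let ?B = "ball ((T ^^ m) z) R" and ?B' = "ball (g z) (2 * L * q)"
        have zJ: "z \<in> J" using z Z(2) by blast
        have sub: "?D \<inter> ball z \<rho> \<subseteq> J \<inter> (T ^^ m) -` (?B \<inter> (T ^^ k) -` ?B')"
          unfolding R_def
          by (rule order_trans[OF _ hit_cylinder_piece_subset[OF L(1,2) 2(5) K \<rho>(3) zJ]]) blast+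
        have bor: "?B \<inter> (T ^^ k) -` ?B' \<in> sets borel"
          by (intro sets.Int vimage_T_pow_borel borel_open open_ball)
        have "J \<inter> (T ^^ m) -` (?B \<inter> (T ^^ k) -` ?B') \<in> sets M"
          unfolding sets_M by (intro sets.Int cylinder_borel[OF J] vimage_T_pow_borel[OF bor])
        with sub have "measure M (?D \<inter> ball z \<rho>) \<le> measure M (J \<inter> (T ^^ m) -` (?B \<inter> (T ^^ k) -` ?B'))"
          by (rule finite_measure_mono)
        also have "\<dots> \<le> c * measure M (?B \<inter> (T ^^ k) -` ?B')"
          unfolding c_def by (rule measure_cylinder_vimage_le[OF m J bor])
        also have "\<dots> \<le> c * ((\<eta>2 * R powr \<delta> + a k) * Q)"
        proof (rule mult_left_mono[OF _ c])
          have "measure M (?B \<inter> (T ^^ k) -` ?B') \<le> (measure M ?B + a k) * measure M ?B'"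
            using mixing[of R "2 * L * q" k "(T ^^ m) z" "g z"] R q L(2) k
            unfolding abs_le_iff by (simp only: distrib_right) simp
          also have "\<dots> \<le> (\<eta>2 * R powr \<delta> + a k) * Q"
            unfolding Q_def
            by (intro mult_mono add_right_mono ball_upper R q add_nonneg_nonneg mult_nonneg_nonneg)
              (use q L(2) a_pos[OF k] \<eta>2_pos in simp_all)
          finally show "measure M (?B \<inter> (T ^^ k) -` ?B') \<le> (\<eta>2 * R powr \<delta> + a k) * Q" .
        qed
        finally show ?thesis .
      qed
      have "?D \<in> sets M"
        unfolding sets_M by (intro sets.Int cylinder_borel[OF J] hit_borel[OF L(1)])
      then have Dz: "?D \<inter> ball z \<rho> \<in> sets M" for z
        by (rule sets.Int) simp
      have "measure M ?D \<le> measure M (\<Union>z\<in>Z. ?D \<inter> ball z \<rho>)"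
      proof (rule finite_measure_mono)
        show "?D \<subseteq> (\<Union>z\<in>Z. ?D \<inter> ball z \<rho>)" using Z(4) by blast
        show "(\<Union>z\<in>Z. ?D \<inter> ball z \<rho>) \<in> sets M" using Z(1) Dz by (rule sets.finite_UN)
      qed
      also have "\<dots> \<le> (\<Sum>z\<in>Z. measure M (?D \<inter> ball z \<rho>))"
      proof (rule finite_measure_subadditive_finite[OF Z(1)])
        show "(\<lambda>z. ?D \<inter> ball z \<rho>) ` Z \<subseteq> sets M" using Dz by blast
      qed
      also have "\<dots> \<le> (\<Sum>z\<in>Z. c * ((\<eta>2 * R powr \<delta> + a k) * Q))" by (intro sum_mono piece)
      also have "\<dots> = real (card Z) * (c * ((\<eta>2 * R powr \<delta> + a k) * Q))" by simp
      also have "\<dots> \<le> (\<eta>2 / \<eta>1 * 4 powr \<delta> * (s/\<rho>) powr \<delta>) * (c * ((\<eta>2 * R powr \<delta> + a k) * Q))"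
        using cardZ c Q \<eta>2_pos a_pos[OF k] by (intro mult_right_mono) auto
      also have "\<dots> = \<eta>2 / \<eta>1 * 4 powr \<delta> * c * (\<eta>2 * (2 * L) powr \<delta>) *
          ((s/\<rho>) powr \<delta> * (\<eta>2 * R powr \<delta> + a k) * q powr \<delta>)"
      proof -
        have "(2 * L * q) powr \<delta> = (2 * L) powr \<delta> * q powr \<delta>"
          by (rule powr_mult)
        then show ?thesis unfolding Q_def by (simp only: mult_ac)
      qed
      also have "\<dots> \<le> \<eta>2 / \<eta>1 * 4 powr \<delta> * c * (\<eta>2 * (2 * L) powr \<delta>) *
          (4 powr \<delta> * (1 + \<eta>2 * (K1\<^sup>2) powr \<delta>) *
            (p powr \<delta> * q powr \<delta> + a k * (p powr \<delta> + q powr \<delta>)))"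
      proof (rule mult_left_mono)
        show "(s/\<rho>) powr \<delta> * (\<eta>2 * R powr \<delta> + a k) * q powr \<delta> \<le>
            4 powr \<delta> * (1 + \<eta>2 * (K1\<^sup>2) powr \<delta>) *
              (p powr \<delta> * q powr \<delta> + a k * (p powr \<delta> + q powr \<delta>))"
        proof -
          have "K1\<^sup>2 > 0" using K1_ge_1 by simp
          then show ?thesis
            unfolding R_def \<rho>_def
            by (rule powr_min_split[OF s(1) q(1) p(1) 2(1) _ \<delta>_pos
                  less_imp_le[OF \<eta>2_pos] less_imp_le[OF a_pos[OF k]] s(2) s4])
        qed
        show "0 \<le> \<eta>2 / \<eta>1 * 4 powr \<delta> * c * (\<eta>2 * (2 * L) powr \<delta>)"
          by (intro mult_nonneg_nonneg divide_nonneg_nonneg powr_ge_zero c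
              less_imp_le[OF \<eta>1_pos] less_imp_le[OF \<eta>2_pos])
      qed
      also have "\<dots> = ?rhs" unfolding pair_const_def c_def by (simp only: mult_ac)
      finally show ?thesis .
    qed
  }
qed

end

section \<open>Moment bounds\<close>

text \<open>Integrate the square of the counting function minus \<open>t\<close> times the indicator
  of \<open>D\<close>. This is Cauchy-Schwarz with a free parameter in place of a square
  root.\<close>

lemma (in finite_measure) sum_measure_Int_le:
  assumes F: "finite F" and A: "\<And>n. n \<in> F \<Longrightarrow> A n \<in> sets M" and D: "D \<in> sets M"
  shows "2 * t * (\<Sum>n\<in>F. measure M (A n \<inter> D)) \<le>
    (\<Sum>m\<in>F. \<Sum>n\<in>F. measure M (A m \<inter> A n)) + t\<^sup>2 * measure M D"
proof -
  let ?f = "\<lambda>x. ((\<Sum>n\<in>F. indicator (A n) x) - t * indicator D x) ^ 2 :: real"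
  have f: "?f x = (\<Sum>m\<in>F. \<Sum>n\<in>F. indicator (A m \<inter> A n) x) - 2 * t * (\<Sum>n\<in>F. indicator (A n \<inter> D) x)
      + t\<^sup>2 * indicator D x" for x
  proof -
    have "((\<Sum>n\<in>F. indicator (A n) x)::real)\<^sup>2 = (\<Sum>m\<in>F. \<Sum>n\<in>F. indicator (A m \<inter> A n) x)"
      by (simp add: power2_eq_square sum_product indicator_inter_arith)
    moreover have "(\<Sum>n\<in>F. indicator (A n) x) * (indicator D x :: real) = (\<Sum>n\<in>F. indicator (A n \<inter> D) x)"
      by (simp add: sum_distrib_right indicator_inter_arith)
    moreover have "(t * indicator D x)\<^sup>2 = t\<^sup>2 * indicator D x" by (simp add: indicator_def)
    ultimately show ?thesis by (simp add: power2_diff algebra_simps)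
  qed
  have int: "integrable M (indicator B :: _ \<Rightarrow> real)" if "B \<in> sets M" for B
    using that by (simp add: integrable_indicator_iff less_top[symmetric])
  have "0 \<le> (\<integral>x. ?f x \<partial>M)" by (intro integral_nonneg_AE) simp
  also have "\<dots> = (\<Sum>m\<in>F. \<Sum>n\<in>F. measure M (A m \<inter> A n)) - 2 * t * (\<Sum>n\<in>F. measure M (A n \<inter> D))
      + t\<^sup>2 * measure M D"
    unfolding f using A D int
    by (simp add: Bochner_Integration.integral_sum sets.Int)
  finally show ?thesis by simp
qed

text \<open>In \<open>m - n + (n - m)\<close> one of the two truncated differences vanishes.\<close>

lemma sum_abs_diff_le:
  fixes \<alpha> :: "nat \<Rightarrow> real"
  assumes "finite F" "summable \<alpha>" "\<And>k. \<alpha> k \<ge> 0"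
  shows "(\<Sum>n\<in>F. \<alpha> (m - n + (n - m))) \<le> 2 * suminf \<alpha>"
proof -
  have le: "(\<Sum>n\<in>G. \<alpha> (h n)) \<le> suminf \<alpha>" if "finite G" "inj_on h G" for G :: "nat set" and h
  proof -
    have "(\<Sum>n\<in>G. \<alpha> (h n)) = sum \<alpha> (h ` G)" using that by (simp add: sum.reindex)
    also have "\<dots> \<le> suminf \<alpha>" using that assms by (intro sum_le_suminf) auto
    finally show ?thesis .
  qed
  \<comment> \<open>On each side of \<open>m\<close> the distance to \<open>m\<close> is an
    injective function of \<open>n\<close>, so each half is at most the full series.\<close>
  have "(\<Sum>n\<in>F. \<alpha> (m - n + (n - m))) =
      (\<Sum>n\<in>F \<inter> {..m}. \<alpha> (m - n + (n - m))) + (\<Sum>n\<in>F - {..m}. \<alpha> (m - n + (n - m)))"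
    using assms(1) by (rule sum.Int_Diff)
  also have "\<dots> \<le> suminf \<alpha> + suminf \<alpha>"
    using assms(1) by (intro add_mono le) (auto simp: inj_on_def)
  finally show ?thesis by simp
qed

context mixing_expanding_system
begin

lemma expansion_ge_eventually:
  "\<exists>m0. \<forall>m\<ge>m0. \<forall>J\<in>cylinders T I P m. ennreal c \<le> expansion T m J"
proof -
  have "eventually (\<lambda>m. ennreal c < (INF J\<in>cylinders T I P m. expansion T m J)) sequentially"
    using expansion_tendsto by (rule order_tendstoD) simp
  then obtain m0 where m0: "\<And>m. m \<ge> m0 \<Longrightarrow> ennreal c < (INF J\<in>cylinders T I P m. expansion T m J)"
    by (auto simp: eventually_sequentially)
  have "ennreal c \<le> expansion T m J" if "m \<ge> m0" "J \<in> cylinders T I P m" for m J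
  proof -
    have "(INF J\<in>cylinders T I P m. expansion T m J) \<le> expansion T m J"
      using that(2) by (rule INF_lower)
    then show ?thesis using m0[OF that(1)] by simp
  qed
  then show ?thesis by blast
qed

lemma hit_measure_bounds:
  assumes L: "L-lipschitz_on UNIV g" "L \<ge> 1"
    and \<psi>_pos: "\<And>n. n \<ge> 1 \<Longrightarrow> \<psi> n > 0" and \<psi>: "\<psi> \<longlonglongrightarrow> 0"
  obtains m0 where "m0 \<ge> 1"
    and "\<And>m. m \<ge> m0 \<Longrightarrow> measure M (hit g m (\<psi> m)) \<le> \<eta>2 * 8 powr \<delta> * S * \<psi> m powr \<delta>"
    and "\<And>m k. m \<ge> m0 \<Longrightarrow> k \<ge> 1 \<Longrightarrow>
      measure M (hit g m (\<psi> m) \<inter> hit g (m + k) (\<psi> (m + k))) \<le> pair_const L * S *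
        (\<psi> m powr \<delta> * \<psi> (m + k) powr \<delta> + a k * (\<psi> m powr \<delta> + \<psi> (m + k) powr \<delta>))"
proof -
  obtain m1 where m1: "\<And>m J. m \<ge> m1 \<Longrightarrow> J \<in> cylinders T I P m \<Longrightarrow> ennreal (2 * L) \<le> expansion T m J"
    using expansion_ge_eventually by blast
  \<comment> \<open>The sum of the three multiples of the radius that must stay below
    \<open>r0\<close>, so one threshold serves all of them.\<close>
  define C where "C = 8 + 4 * K1\<^sup>2 + 2 * L"
  have C: "C > 0" using L(2) by (simp add: C_def add_pos_nonneg)
  have "eventually (\<lambda>m. \<psi> m < r0 / C) sequentially"
    using \<psi> by (rule order_tendstoD) (use C r0_pos in simp)
  then obtain m2 where m2: "\<And>m. m \<ge> m2 \<Longrightarrow> \<psi> m < r0 / C" by (auto simp: eventually_sequentially)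
  have small: "8 * \<psi> m < r0" "4 * K1\<^sup>2 * \<psi> m < r0" "2 * L * \<psi> m < r0" if "m \<ge> m2" "m \<ge> 1" for m
  proof -
    have le: "c * \<psi> m < r0" if "c \<le> C" for c
    proof -
      have "c * \<psi> m \<le> C * \<psi> m"
        using that \<psi>_pos[OF \<open>m \<ge> 1\<close>] by (intro mult_right_mono) auto
      also have "\<dots> < r0" using m2[OF \<open>m \<ge> m2\<close>] C by (simp add: field_simps)
      finally show ?thesis .
    qed
    show "8 * \<psi> m < r0" "4 * K1\<^sup>2 * \<psi> m < r0" "2 * L * \<psi> m < r0"
      using L(2) by (auto simp: C_def intro!: le)
  qed
  define m0 where "m0 = max 1 (max m1 m2)"
  have m0: "m \<ge> 1" "m \<ge> m1" "m \<ge> m2" if "m \<ge> m0" for m using that by (auto simp: m0_def)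
  show ?thesis
  proof
    show "m0 \<ge> 1" by (simp add: m0_def)
  next
    fix m assume m: "m \<ge> m0"
    have "measure M (hit g m (\<psi> m)) \<le> (\<eta>2 * 8 powr \<delta> * \<psi> m powr \<delta>) * S"
      using m0[OF m] m1 small[OF m0(3,1)[OF m]] \<psi>_pos[OF m0(1)[OF m]] L hit_borel[OF L(1)] \<eta>2_pos
      by (intro measure_le_sum_cylinders[OF m0(1)[OF m]] measure_cylinder_hit_le[where L = L]) auto
    then show "measure M (hit g m (\<psi> m)) \<le> \<eta>2 * 8 powr \<delta> * S * \<psi> m powr \<delta>"
      by (simp only: mult_ac)
  next
    fix m k :: nat assume m: "m \<ge> m0" and k: "k \<ge> 1"
    let ?p = "\<psi> m powr \<delta>" and ?q = "\<psi> (m + k) powr \<delta>"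
    have mk: "m + k \<ge> m0" using m by simp
    have "measure M (hit g m (\<psi> m) \<inter> hit g (m + k) (\<psi> (m + k))) \<le>
        (pair_const L * (?p * ?q + a k * (?p + ?q))) * S"
    proof (rule measure_le_sum_cylinders[OF m0(1)[OF m]])
      show "hit g m (\<psi> m) \<inter> hit g (m + k) (\<psi> (m + k)) \<in> sets borel"
        using hit_borel[OF L(1)] by (intro sets.Int)
      show "0 \<le> pair_const L * (?p * ?q + a k * (?p + ?q))"
        using pair_const_pos[OF L(2)] a_pos[OF k] by (intro mult_nonneg_nonneg add_nonneg_nonneg) auto
      fix J assume J: "J \<in> cylinders T I P m"
      show "measure M (J \<inter> (hit g m (\<psi> m) \<inter> hit g (m + k) (\<psi> (m + k)))) \<le>
          pair_const L * (?p * ?q + a k * (?p + ?q)) * weight m J"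
        by (intro measure_cylinder_hit_hit_le m0[OF m] k J L m1 small \<psi>_pos m0(1)[OF mk] m0(3)[OF mk])
    qed
    then show "measure M (hit g m (\<psi> m) \<inter> hit g (m + k) (\<psi> (m + k))) \<le> pair_const L * S *
        (?p * ?q + a k * (?p + ?q))"
      by (simp only: mult_ac)
  qed
qed

section \<open>The limsup set and the convergent case\<close>

text \<open>Tails start at \<open>Suc N\<close> because time 0 is excluded from the recurrence
  set.\<close>

lemma recurrence_set_eq:
  "recurrence_set T g \<psi> = (\<Inter>N. \<Union>n\<in>{Suc N..}. hit g n (\<psi> n))"
proof -
  have *: "infinite {n. n \<ge> 1 \<and> Q n} \<longleftrightarrow> (\<forall>N. \<exists>n\<in>{Suc N..}. Q n)" (is "?l \<longleftrightarrow> ?r") for Q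
  proof
    assume ?l
    then have "\<exists>n>N. n \<in> {n. n \<ge> 1 \<and> Q n}" for N by (simp only: infinite_nat_iff_unbounded)
    then show ?r unfolding Bex_def atLeast_iff Suc_le_eq by auto
  next
    assume r: ?r
    have "\<exists>n>N. n \<in> {n. n \<ge> 1 \<and> Q n}" for N
    proof -
      obtain n where "n \<ge> Suc N" "Q n" using r by (meson atLeast_iff)
      then show ?thesis by (intro exI[of _ n]) auto
    qed
    then show ?l unfolding infinite_nat_iff_unbounded by blast
  qed
  show ?thesis
    by (intro set_eqI) (simp only: recurrence_set_def hit_def mem_Collect_eq * INT_iff UN_iff ball_UNIV)
qed

lemma recurrence_set_borel:
  "L-lipschitz_on UNIV g \<Longrightarrow> recurrence_set T g \<psi> \<in> sets borel"
  unfolding recurrence_set_eq by (intro sets.countable_INT' sets.countable_UN') (auto intro: hit_borel)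

lemma recurrence_set_null:
  assumes L: "L-lipschitz_on UNIV g" "L \<ge> 1"
    and \<psi>_pos: "\<And>n. n \<ge> 1 \<Longrightarrow> \<psi> n > 0" and \<psi>: "\<psi> \<longlonglongrightarrow> 0"
    and sum: "summable (\<lambda>n. \<psi> n powr \<delta>)"
  shows "recurrence_set T g \<psi> \<in> null_sets M"
proof -
  obtain m0 where m0:
    "\<And>m. m \<ge> m0 \<Longrightarrow> measure M (hit g m (\<psi> m)) \<le> \<eta>2 * 8 powr \<delta> * S * \<psi> m powr \<delta>"
    using hit_measure_bounds[OF L \<psi>_pos \<psi>] by metis
  let ?A = "\<lambda>n. hit g n (\<psi> n)"
  have "summable (\<lambda>n. measure M (?A n))"
    by (rule summable_comparison_test'[OF summable_mult[OF sum], where N = m0])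
      (use m0 in simp)
  then have null: "limsup ?A \<in> null_sets M"
    using hit_borel[OF L(1)] by (intro borel_cantelli_limsup1) (auto simp: less_top[symmetric])
  have "recurrence_set T g \<psi> \<subseteq> limsup ?A"
    unfolding recurrence_set_eq limsup_INF_SUP
  proof (rule INF_mono)
    fix m :: nat
    have "(\<Union>n\<in>{Suc m..}. ?A n) \<subseteq> (\<Union>n\<in>{m..}. ?A n)" by (intro UN_mono) auto
    then show "\<exists>N\<in>UNIV. (\<Union>n\<in>{Suc N..}. ?A n) \<subseteq> (\<Union>n\<in>{m..}. ?A n)" by (rule bexI) (rule UNIV_I)
  qed
  moreover have "recurrence_set T g \<psi> \<in> sets M"
    unfolding sets_M by (rule recurrence_set_borel[OF L(1)])
  ultimately show ?thesis using null by (metis null_sets_subset)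
qed

section \<open>Lower bounds for hitting sets\<close>

text \<open>Within \<open>ball z \<rho>\<close> the target moves by less than \<open>q/2\<close>, so
  landing within \<open>q/2\<close> of \<open>g z\<close> is a hit. The condition on
  \<open>a n\<close> lets the mixing error consume at most half of the lower bound for the measure
  of \<open>ball z \<rho>\<close>.\<close>

lemma measure_ball_hit_ge:
  assumes L: "L-lipschitz_on UNIV g" "L \<ge> 1" and n: "n \<ge> 1"
    and q: "q > 0" "q < r0" and \<rho>: "\<rho> = q / (2 * L)" and an: "a n \<le> \<eta>1 * \<rho> powr \<delta> / 2"
  shows "\<eta>1 * \<rho> powr \<delta> / 2 * (\<eta>1 * (q/2) powr \<delta>) \<le> measure M (ball z \<rho> \<inter> hit g n q)"
proof -
  have L0: "L > 0" using L(2) by simp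
  have \<rho>0: "\<rho> > 0" using L0 q by (simp add: \<rho>)
  have "q / (2 * L) \<le> q" using L(2) q by (simp add: pos_divide_le_eq)
  then have \<rho>r: "\<rho> < r0" using q by (simp add: \<rho>)
  let ?B = "ball z \<rho>" and ?B' = "ball (g z) (q/2)"
  have sub: "?B \<inter> (T ^^ n) -` ?B' \<subseteq> ?B \<inter> hit g n q"
  proof
    fix x assume x: "x \<in> ?B \<inter> (T ^^ n) -` ?B'"
    have "dist ((T ^^ n) x) (g x) \<le> dist (g z) ((T ^^ n) x) + dist (g z) (g x)"
      by (rule dist_triangle3)
    also have "dist (g z) (g x) \<le> L * dist z x" using lipschitz_onD[OF L(1)] by simp
    also have "dist z x < \<rho>" using x by simp
    then have "L * dist z x < q / 2" using L0 by (simp add: \<rho> field_simps)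
    also have "dist (g z) ((T ^^ n) x) < q / 2" using x by simp
    finally show "x \<in> ?B \<inter> hit g n q" using x by (simp add: hit_def)
  qed
  have "\<eta>1 * \<rho> powr \<delta> / 2 * (\<eta>1 * (q/2) powr \<delta>) \<le> (measure M ?B - a n) * measure M ?B'"
  proof (rule mult_mono)
    have "0 \<le> \<eta>1 * \<rho> powr \<delta>" using \<eta>1_pos by simp
    then show "\<eta>1 * \<rho> powr \<delta> / 2 \<le> measure M ?B - a n" "0 \<le> measure M ?B - a n"
      using ball_lower[OF \<rho>0 \<rho>r, of z] an by linarith+
    show "\<eta>1 * (q/2) powr \<delta> \<le> measure M ?B'" using q by (intro ball_lower) auto
    show "0 \<le> \<eta>1 * (q/2) powr \<delta>" using \<eta>1_pos by simp
  qed
  also have "\<dots> \<le> measure M (?B \<inter> (T ^^ n) -` ?B')"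
    using mixing[of \<rho> "q/2" n z "g z"] \<rho>0 q n unfolding abs_le_iff left_diff_distrib by simp
  also have "\<dots> \<le> measure M (?B \<inter> hit g n q)"
    using hit_borel[OF L(1)] by (intro finite_measure_mono[OF sub]) simp
  finally show ?thesis .
qed

text \<open>The lower bound of \<open>measure_ball_hit_ge\<close> divided by the Ahlfors upper bound
  for a ball of radius \<open>2 * \<rho>\<close> and by \<open>q powr \<delta>\<close>; the radius
  \<open>\<rho>\<close> cancels.\<close>

definition hit_const :: real where
  "hit_const = \<eta>1\<^sup>2 / (2 * \<eta>2 * 4 powr \<delta>)"

lemma hit_const_pos: "hit_const > 0"
  using \<eta>1_pos \<eta>2_pos by (simp add: hit_const_def)

text \<open>A \<open>2 * \<rho>\<close>-separated net of \<open>K\<close> has disjoint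
  \<open>\<rho>\<close>-balls inside \<open>U\<close>, each contributing the local bound, while its
  \<open>2 * \<rho>\<close>-balls cover \<open>K\<close> and so bound its cardinality below.\<close>

lemma measure_open_hit_ge:
  assumes L: "L-lipschitz_on UNIV g" "L \<ge> 1" and n: "n \<ge> 1"
    and q: "q > 0" "q < r0" and \<rho>: "\<rho> = q / (2 * L)" and an: "a n \<le> \<eta>1 * \<rho> powr \<delta> / 2"
    and U: "U \<in> sets borel" "(\<Union>x\<in>K. ball x t) \<subseteq> U" "\<rho> \<le> t"
  shows "hit_const * q powr \<delta> * measure M K \<le> measure M (hit g n q \<inter> U)"
proof -
  have L0: "L > 0" using L(2) by simp
  have \<rho>0: "\<rho> > 0" using L0 q by (simp add: \<rho>)
  have \<rho>2: "2 * \<rho> > 0" using \<rho>0 by simp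
  have "2 * \<rho> \<le> q" using L(2) q by (simp add: \<rho> pos_divide_le_eq)
  then have \<rho>r: "2 * \<rho> < r0" using q by simp
  obtain Z where Z: "finite Z" "Z \<subseteq> K" "separated (2 * \<rho>) Z" "K \<subseteq> (\<Union>z\<in>Z. ball z (2 * \<rho>))"
    using compact_finite_separated_net[OF compact_UNIV \<rho>2] .
  have hb: "hit g n q \<in> sets M" using hit_borel[OF L(1)] by simp
  have disj: "disjoint_family_on (\<lambda>z. ball z \<rho> \<inter> hit g n q) Z"
    using separated_disjoint_balls[OF Z(3)] by (auto simp: disjoint_family_on_def)
  have "measure M K \<le> real (card Z) * (\<eta>2 * (2 * \<rho>) powr \<delta>)"
    using measure_le_card_net[OF Z(1) \<rho>2 \<rho>r Z(4)] .
  then have "hit_const * q powr \<delta> * measure M K \<le>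
      hit_const * q powr \<delta> * (real (card Z) * (\<eta>2 * (2 * \<rho>) powr \<delta>))"
    using hit_const_pos by (intro mult_left_mono) auto
  also have "\<dots> = real (card Z) * (\<eta>1 * \<rho> powr \<delta> / 2 * (\<eta>1 * (q/2) powr \<delta>))"
  proof -
    have "(2 * \<rho>) powr \<delta> = 2 powr \<delta> * \<rho> powr \<delta>" "q powr \<delta> = 2 powr \<delta> * (q/2) powr \<delta>"
      "(4::real) powr \<delta> = 2 powr \<delta> * 2 powr \<delta>"
      using \<rho>0 q by (simp_all flip: powr_mult)
    then show ?thesis using \<eta>1_pos \<eta>2_pos
      by (simp add: hit_const_def power2_eq_square field_simps)
  qed
  also have "\<dots> = (\<Sum>z\<in>Z. \<eta>1 * \<rho> powr \<delta> / 2 * (\<eta>1 * (q/2) powr \<delta>))" by simp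
  also have "\<dots> \<le> (\<Sum>z\<in>Z. measure M (ball z \<rho> \<inter> hit g n q))"
    by (intro sum_mono measure_ball_hit_ge[where L = L] L n q \<rho> an)
  also have "\<dots> = measure M (\<Union>z\<in>Z. ball z \<rho> \<inter> hit g n q)"
    using Z(1) hb disj by (intro finite_measure_finite_Union[symmetric]) auto
  also have "\<dots> \<le> measure M (hit g n q \<inter> U)"
  proof (rule finite_measure_mono)
    have "ball z \<rho> \<subseteq> U" if "z \<in> Z" for z
    proof -
      have "ball z \<rho> \<subseteq> ball z t" using U(3) by (rule subset_ball)
      also have "ball z t \<subseteq> U"
        using U(2) subsetD[OF Z(2) that] by (simp only: UN_subset_iff)
      finally show ?thesis .
    qed
    then show "(\<Union>z\<in>Z. ball z \<rho> \<inter> hit g n q) \<subseteq> hit g n q \<inter> U"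
      by (intro UN_least) blast
    show "hit g n q \<inter> U \<in> sets M" using hb U(1) by auto
  qed
  finally show ?thesis .
qed


text \<open>Positivity is assumed from index 1 on, so \<open>a 0\<close> may be negative; absolute
  values provide a nonnegative sequence on all of \<open>nat\<close>.\<close>

lemma summable_abs_a: "summable (\<lambda>k. \<bar>a k\<bar>)"
proof -
  have "\<bar>a (Suc n)\<bar> = a (Suc n)" for n using a_pos[of "Suc n"] by simp
  then have "summable (\<lambda>n. \<bar>a (Suc n)\<bar>)" using summable_a by (simp add: summable_Suc_iff)
  then show ?thesis by (simp only: summable_Suc_iff[of "\<lambda>n. \<bar>a n\<bar>"])
qed

text \<open>The diagonal uses the one-time bound, the rest the pair bound and symmetry. The factor 4
  comes from two symmetric error terms, each summed over both sides of the diagonal.\<close>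

lemma sum_sum_hit_le:
  assumes F: "finite F" "F \<subseteq> {m0..}"
    and b: "\<And>n. n \<in> F \<Longrightarrow> b n \<ge> (0::real)"
    and hb: "\<And>n. A n \<in> sets M"
    and single: "\<And>m. m \<ge> m0 \<Longrightarrow> measure M (A m) \<le> C1 * b m"
    and pair: "\<And>m k. m \<ge> m0 \<Longrightarrow> k \<ge> 1 \<Longrightarrow>
      measure M (A m \<inter> A (m + k)) \<le> C2 * (b m * b (m + k) + a k * (b m + b (m + k)))"
    and C2: "C2 \<ge> 0"
  shows "(\<Sum>m\<in>F. \<Sum>n\<in>F. measure M (A m \<inter> A n)) \<le>
    (C1 + 4 * C2 * (\<Sum>k. \<bar>a k\<bar>)) * sum b F + C2 * (sum b F)\<^sup>2"
proof -
  define \<alpha> where "\<alpha> k = \<bar>a k\<bar>" for k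
  have a: "summable \<alpha>" unfolding \<alpha>_def by (rule summable_abs_a)
  let ?d = "\<lambda>m n :: nat. m - n + (n - m)" and ?s = "sum b F"
  let ?r = "\<lambda>m n. C2 * (b m * b n) + C2 * (\<alpha> (?d m n) * b m) + C2 * (\<alpha> (?d m n) * b n)"
  have r0: "?r m n \<ge> 0" if "m \<in> F" "n \<in> F" for m n
    using C2 b that by (simp add: \<alpha>_def)
  have less_le: "measure M (A m \<inter> A n) \<le> ?r m n" if "m \<in> F" "n \<in> F" "m < n" for m n
  proof -
    have "measure M (A m \<inter> A (m + (n - m))) \<le>
        C2 * (b m * b (m + (n - m)) + a (n - m) * (b m + b (m + (n - m))))"
      using that F(2) by (intro pair) auto
    moreover have "a (n - m) = \<alpha> (?d m n)"
    proof -
      have "n - m \<ge> 1" "m - n = 0" using that(3) by auto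
      then show ?thesis using a_pos[of "n - m"] unfolding \<alpha>_def by simp
    qed
    moreover have "m + (n - m) = n" using that(3) by simp
    ultimately show ?thesis by (simp only: distrib_left add.assoc mult.assoc)
  qed
  have le: "measure M (A m \<inter> A n) \<le> (if n = m then C1 * b m else 0) + ?r m n"
    if mn: "m \<in> F" "n \<in> F" for m n
  proof (cases m n rule: linorder_cases)
    case less
    then show ?thesis using less_le[OF mn] by simp
  next
    case equal
    then show ?thesis using single[of m] r0[OF mn] mn F(2) by auto
  next
    case greater
    have "measure M (A n \<inter> A m) \<le> ?r n m" by (rule less_le[OF mn(2,1) greater])
    also have "?r n m = ?r m n" by (simp only: add_ac mult_ac)
    finally show ?thesis using greater by (simp add: Int_commute)
  qed
  have \<alpha>sum: "(\<Sum>n\<in>F. \<alpha> (?d m n)) \<le> 2 * suminf \<alpha>" for m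
    using F(1) a by (rule sum_abs_diff_le) (simp add: \<alpha>_def)
  have e1: "(\<Sum>m\<in>F. \<Sum>n\<in>F. \<alpha> (?d m n) * b m) \<le> 2 * suminf \<alpha> * ?s"
  proof -
    have "(\<Sum>m\<in>F. \<Sum>n\<in>F. \<alpha> (?d m n) * b m) = (\<Sum>m\<in>F. (\<Sum>n\<in>F. \<alpha> (?d m n)) * b m)"
      by (simp only: sum_distrib_right)
    also have "\<dots> \<le> (\<Sum>m\<in>F. 2 * suminf \<alpha> * b m)"
      using \<alpha>sum b by (intro sum_mono mult_right_mono) auto
    finally show ?thesis by (simp only: sum_distrib_left)
  qed
  have e2: "(\<Sum>m\<in>F. \<Sum>n\<in>F. \<alpha> (?d m n) * b n) = (\<Sum>m\<in>F. \<Sum>n\<in>F. \<alpha> (?d m n) * b m)"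
    by (subst sum.swap) (simp only: add.commute)
  have e3: "(\<Sum>m\<in>F. b m * ?s) = ?s\<^sup>2"
    by (simp only: power2_eq_square sum_distrib_right)
  have "(\<Sum>m\<in>F. \<Sum>n\<in>F. measure M (A m \<inter> A n)) \<le>
      (\<Sum>m\<in>F. \<Sum>n\<in>F. (if n = m then C1 * b m else 0) + ?r m n)"
    by (intro sum_mono le)
  also have "\<dots> = C1 * ?s + (C2 * ?s\<^sup>2 + C2 * (\<Sum>m\<in>F. \<Sum>n\<in>F. \<alpha> (?d m n) * b m)
      + C2 * (\<Sum>m\<in>F. \<Sum>n\<in>F. \<alpha> (?d m n) * b m))"
  proof -
    have "(\<Sum>m\<in>F. \<Sum>n\<in>F. if n = m then C1 * b m else 0) = (\<Sum>m\<in>F. C1 * b m)"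
      using F(1) by (intro sum.cong) (simp_all add: sum.delta)
    then show ?thesis
      by (simp only: sum.distrib sum_distrib_left[symmetric] e2 e3)
  qed
  also have "\<dots> \<le> C1 * ?s + (C2 * ?s\<^sup>2 + C2 * (2 * suminf \<alpha> * ?s) + C2 * (2 * suminf \<alpha> * ?s))"
    by (intro add_mono order_refl mult_left_mono[OF e1 C2])
  also have "\<dots> = (C1 + 4 * C2 * suminf \<alpha>) * ?s + C2 * ?s\<^sup>2"
    by (simp add: algebra_simps)
  finally show ?thesis unfolding \<alpha>_def .
qed

end

section \<open>The divergent case\<close>

context mixing_expanding_system
begin

text \<open>Suppose \<open>Y\<close> meets the limsup set in a null set. Removing a tail of the hitting sets leaves
  \<open>Y'\<close> of positive measure that they all miss, so an open \<open>U\<close> slightly larger than \<open>Y'\<close> meets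
  them only inside \<open>U - Y'\<close>. The lower bound on \<open>U\<close> is then incompatible with the second moment
  bound once \<open>U - Y'\<close> is small. Times \<open>n\<close> at which \<open>\<psi>(n)\<^sup>\<delta>\<close> is dominated by the mixing rate
  contribute a convergent series and are discarded.\<close>

lemma recurrence_set_meets:
  assumes L: "L-lipschitz_on UNIV g" "L \<ge> 1"
    and \<psi>_pos: "\<And>n. n \<ge> 1 \<Longrightarrow> \<psi> n > 0" and \<psi>: "\<psi> \<longlonglongrightarrow> 0"
    and div: "\<not> summable (\<lambda>n. \<psi> n powr \<delta>)"
    and Y: "Y \<in> sets borel" "measure M Y > 0"
  shows "measure M (Y \<inter> recurrence_set T g \<psi>) > 0"
proof (rule ccontr)
  let ?R = "recurrence_set T g \<psi>"
  assume "\<not> measure M (Y \<inter> ?R) > 0"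
  then have YR: "measure M (Y \<inter> ?R) = 0" by (simp add: zero_less_measure_iff)
  define A where "A n = hit g n (\<psi> n)" for n
  define b where "b n = \<psi> n powr \<delta>" for n
  have Ab: "A n \<in> sets borel" for n unfolding A_def by (rule hit_borel[OF L(1)])
  have b: "b n \<ge> 0" for n by (simp add: b_def)

  \<comment> \<open>The tails decrease to the recurrence set, so some tail leaves part of
    \<open>Y\<close> uncovered.\<close>
  define V where "V N = (\<Union>n\<in>{Suc N..}. A n)" for N
  have Vb: "V N \<in> sets borel" for N unfolding V_def using Ab by (intro sets.countable_UN') auto
  have "(\<lambda>N. measure M (Y \<inter> V N)) \<longlonglongrightarrow> measure M (\<Inter>N. Y \<inter> V N)"
  proof (rule finite_Lim_measure_decseq)
    show "range (\<lambda>N. Y \<inter> V N) \<subseteq> sets M" using Y Vb by auto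
    have "V (Suc N) \<subseteq> V N" for N unfolding V_def by (intro UN_mono) auto
    then show "decseq (\<lambda>N. Y \<inter> V N)" unfolding decseq_Suc_iff by (meson Int_mono order_refl)
  qed
  moreover have "(\<Inter>N. Y \<inter> V N) = Y \<inter> ?R" unfolding recurrence_set_eq V_def A_def by auto
  ultimately have "(\<lambda>N. measure M (Y \<inter> V N)) \<longlonglongrightarrow> 0" by (simp only: YR)
  then have "eventually (\<lambda>N. measure M (Y \<inter> V N) < measure M Y) sequentially"
    using Y(2) by (rule order_tendstoD)
  then obtain N where N: "measure M (Y \<inter> V N) < measure M Y" by (auto simp: eventually_sequentially)
  define Y' where "Y' = Y - V N"
  have Y'b: "Y' \<in> sets borel" unfolding Y'_def using Y(1) Vb by (rule sets.Diff)
  define y where "y = measure M Y'"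
  have y: "y > 0"
  proof -
    have "measure M (Y - Y \<inter> V N) = measure M Y - measure M (Y \<inter> V N)"
      using Y(1) Vb by (intro finite_measure_Diff) auto
    moreover have "Y - Y \<inter> V N = Y'" by (auto simp: Y'_def)
    ultimately show ?thesis using N by (simp add: y_def)
  qed
  have miss: "A n \<inter> Y' = {}" if "n \<ge> Suc N" for n
    using that by (auto simp: Y'_def V_def)

  define C1 where "C1 = \<eta>2 * 8 powr \<delta> * S"
  define C2 where "C2 = pair_const L * S"
  have C: "C1 \<ge> 0" "C2 \<ge> 0"
    using \<eta>2_pos S_nonneg pair_const_pos[OF L(2)] by (auto simp: C1_def C2_def)
  obtain m0 where m0: "\<And>m. m \<ge> m0 \<Longrightarrow> measure M (A m) \<le> C1 * b m"
    "\<And>m k. m \<ge> m0 \<Longrightarrow> k \<ge> 1 \<Longrightarrow>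
      measure M (A m \<inter> A (m + k)) \<le> C2 * (b m * b (m + k) + a k * (b m + b (m + k)))"
    using hit_measure_bounds[OF L \<psi>_pos \<psi>] unfolding A_def b_def C1_def C2_def by metis
  \<comment> \<open>Collects the linear and the quadratic coefficient, as
    \<open>s \<le> s\<^sup>2\<close> for the sum \<open>s > 1\<close> chosen below; the summand 1
    makes it positive.\<close>
  define C3 where "C3 = C1 + 4 * C2 * (\<Sum>k. \<bar>a k\<bar>) + C2 + 1"
  have suma: "(\<Sum>k. \<bar>a k\<bar>) \<ge> 0" by (rule suminf_nonneg[OF summable_abs_a]) simp
  then have C3: "C3 > 0" using C by (simp add: C3_def add_nonneg_pos)

  \<comment> \<open>With \<open>\<tau>\<close> and \<open>\<epsilon>\<close> balanced like this,
    both terms of the final upper bound are at most a quarter of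
    \<open>\<tau> * s\<^sup>2 * (hit_const * y)\<close>, while the lower bound is all of it.
    Moreover \<open>\<epsilon> \<le> y / 2\<close> leaves \<open>K\<close> half of the mass of
    \<open>Y'\<close>.\<close>
  define \<tau> where "\<tau> = 4 * C3 / (hit_const * y)"
  have hy: "hit_const * y > 0" using hit_const_pos y by simp
  have \<tau>: "\<tau> > 0" using C3 hy by (simp add: \<tau>_def)
  define \<epsilon> where "\<epsilon> = min (y / 2) (hit_const * y / (4 * \<tau>))"
  have \<epsilon>: "\<epsilon> > 0" using y hy \<tau> by (simp add: \<epsilon>_def)
  obtain K U where KU: "closed K" "open U" "K \<subseteq> Y'" "Y' \<subseteq> U"
    "measure M Y' \<le> measure M K + \<epsilon>" "measure M (U - K) < \<epsilon>"
    using approx_open_closed[OF Y'b \<epsilon>] by metis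
  have Kb: "K \<in> sets borel" "U \<in> sets borel" using KU by auto
  have yK: "measure M K \<ge> y / 2"
  proof -
    have "\<epsilon> \<le> y / 2" by (simp only: \<epsilon>_def min.cobounded1)
    then show ?thesis using KU(5)[folded y_def] by linarith
  qed
  have "compact K" using compact_UNIV KU(1) by (metis compact_Int_closed inf_top_left)
  then obtain t where t: "t > 0" "(\<Union>x\<in>K. ball x t) \<subseteq> U"
    using compact_subset_open_imp_ball_epsilon_subset[OF _ KU(2) order_trans[OF KU(3,4)]] by metis

  define G where "G = {n. a n \<le> \<eta>1 * (\<psi> n / (2 * L)) powr \<delta> / 2}"
  define b' where "b' n = (if n \<in> G then b n else 0)" for n
  \<comment> \<open>Chosen so that failure of the condition defining \<open>G\<close> reads
    \<open>b n < c * a n\<close>. Hence discarding these times removes a summable part of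
    \<open>b\<close>.\<close>
  define c where "c = 2 * (2 * L) powr \<delta> / \<eta>1"
  have bb': "b n - b' n \<le> c * a n" "b n - b' n \<ge> 0" if n: "n \<ge> 1" for n
  proof -
    have c: "c > 0" using \<eta>1_pos L(2) by (simp add: c_def)
    show "b n - b' n \<le> c * a n"
    proof (cases "n \<in> G")
      case True
      then show ?thesis using c a_pos[OF n] by (simp add: b'_def)
    next
      case False
      have "b n = c * (\<eta>1 * (\<psi> n / (2 * L)) powr \<delta> / 2)"
        using \<eta>1_pos L(2) \<psi>_pos[OF n] by (simp add: b_def c_def powr_divide)
      also have "\<dots> \<le> c * a n" using False c by (intro mult_left_mono) (auto simp: G_def)
      finally show ?thesis using False by (simp add: b'_def)
    qed
    show "b n - b' n \<ge> 0" using b by (simp add: b'_def)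
  qed
  have div': "\<not> summable b'"
  proof
    assume "summable b'"
    moreover have "summable (\<lambda>n. b n - b' n)"
      by (rule summable_comparison_test'[OF summable_mult[OF summable_a], where N = 1])
        (use bb' in simp)
    ultimately have "summable (\<lambda>n. b' n + (b n - b' n))" by (rule summable_add)
    then show False using div by (simp add: b_def)
  qed

  have "eventually (\<lambda>n. \<psi> n < min r0 t) sequentially"
    using \<psi> by (rule order_tendstoD) (use r0_pos t in simp)
  then obtain n1 where n1: "\<And>n. n \<ge> n1 \<Longrightarrow> \<psi> n < min r0 t" by (auto simp: eventually_sequentially)
  define n0 where "n0 = max (max (Suc N) m0) n1"
  have n0: "n \<ge> Suc N" "n \<ge> 1" "n \<ge> m0" "\<psi> n < r0" "\<psi> n < t" if "n \<ge> n0" for n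
    using that n1[of n] by (auto simp: n0_def)
  \<comment> \<open>Divergence beyond \<open>n0\<close> is used only through one finite block with
    sum above 1.\<close>
  obtain k where k: "(\<Sum>i<k. b' (i + n0)) > 1"
  proof (rule ccontr)
    assume "\<not> thesis"
    then have "(\<Sum>i<k. b' (i + n0)) \<le> 1" for k using that by (meson not_le)
    then have "summable (\<lambda>i. b' (i + n0))"
      using b by (intro summableI_nonneg_bounded) (auto simp: b'_def)
    then show False using div' by (simp only: summable_iff_shift)
  qed
  define F where "F = {n0..<n0 + k} \<inter> G"
  have F: "finite F" "\<And>n. n \<in> F \<Longrightarrow> n \<ge> n0 \<and> n \<in> G" by (auto simp: F_def)
  define s where "s = sum b F"
  have s: "s > 1"
  proof -
    have "(\<Sum>i<k. b' (i + n0)) = (\<Sum>n\<in>{n0..<n0 + k}. b' n)"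
      by (rule sum.reindex_bij_witness[of _ "\<lambda>n. n - n0" "\<lambda>i. i + n0"]) auto
    also have "\<dots> = s" unfolding s_def F_def b'_def by (simp add: sum.inter_restrict)
    finally show ?thesis using k by simp
  qed

  have lower: "hit_const * (y / 2) * s \<le> (\<Sum>n\<in>F. measure M (A n \<inter> U))"
  proof -
    have "hit_const * (y / 2) * s = (\<Sum>n\<in>F. hit_const * b n * (y / 2))"
      unfolding s_def sum_distrib_left by (simp only: mult_ac)
    also have "\<dots> \<le> (\<Sum>n\<in>F. measure M (A n \<inter> U))"
    proof (rule sum_mono)
      fix n assume n: "n \<in> F"
      note nn = n0[OF F(2)[OF n, THEN conjunct1]]
      have "\<psi> n / (2 * L) \<le> \<psi> n"
        using L(2) \<psi>_pos[OF nn(2)] by (simp add: pos_divide_le_eq)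
      then have \<rho>: "\<psi> n / (2 * L) \<le> t" using nn(5) by simp
      have "hit_const * b n * (y / 2) \<le> hit_const * b n * measure M K"
        using yK hit_const_pos b by (intro mult_left_mono) auto
      also have "\<dots> \<le> measure M (A n \<inter> U)"
        unfolding b_def A_def
        using F(2)[OF n] by (intro measure_open_hit_ge[OF L nn(2) \<psi>_pos[OF nn(2)] nn(4) refl _ Kb(2) t(2) \<rho>])
          (simp add: G_def)
      finally show "hit_const * b n * (y / 2) \<le> measure M (A n \<inter> U)" .
    qed
    finally show ?thesis .
  qed
  have upper: "(\<Sum>n\<in>F. measure M (A n \<inter> U)) \<le> (\<Sum>n\<in>F. measure M (A n \<inter> (U - Y')))"
  proof (rule sum_mono)
    fix n assume n: "n \<in> F"
    have "A n \<inter> U = A n \<inter> (U - Y')" using miss[OF n0(1)] F(2)[OF n] by blast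
    then show "measure M (A n \<inter> U) \<le> measure M (A n \<inter> (U - Y'))" by simp
  qed
  have second: "(\<Sum>m\<in>F. \<Sum>n\<in>F. measure M (A m \<inter> A n)) \<le> C3 * s\<^sup>2"
  proof -
    have "F \<subseteq> {m0..}" using F(2) n0(3) by auto
    then have "(\<Sum>m\<in>F. \<Sum>n\<in>F. measure M (A m \<inter> A n)) \<le>
        (C1 + 4 * C2 * (\<Sum>k. \<bar>a k\<bar>)) * s + C2 * s\<^sup>2"
      unfolding s_def using F(1) b Ab m0 C by (intro sum_sum_hit_le[where ?m0.0 = m0]) auto
    also have "\<dots> \<le> (C1 + 4 * C2 * (\<Sum>k. \<bar>a k\<bar>)) * s\<^sup>2 + C2 * s\<^sup>2"
      using s C suma by (intro add_right_mono mult_left_mono) (auto simp: power2_eq_square)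
    also have "\<dots> \<le> C3 * s\<^sup>2" by (simp add: C3_def algebra_simps)
    finally show ?thesis .
  qed
  have small: "measure M (U - Y') \<le> hit_const * y / (4 * \<tau>)"
  proof -
    have "measure M (U - Y') \<le> measure M (U - K)"
      using KU(3) Kb by (intro finite_measure_mono) auto
    then show ?thesis using KU(6) by (simp add: \<epsilon>_def)
  qed
  have "2 * (\<tau> * s) * (\<Sum>n\<in>F. measure M (A n \<inter> (U - Y'))) \<le> C3 * s\<^sup>2 + (\<tau> * s)\<^sup>2 * measure M (U - Y')"
  proof -
    have "U - Y' \<in> sets M" unfolding sets_M by (intro sets.Diff Kb(2) Y'b)
    then have "2 * (\<tau> * s) * (\<Sum>n\<in>F. measure M (A n \<inter> (U - Y'))) \<le>
        (\<Sum>m\<in>F. \<Sum>n\<in>F. measure M (A m \<inter> A n)) + (\<tau> * s)\<^sup>2 * measure M (U - Y')"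
      by (intro sum_measure_Int_le F(1)) (simp_all add: Ab)
    then show ?thesis using second by linarith
  qed
  also have "\<dots> \<le> C3 * s\<^sup>2 + (\<tau> * s)\<^sup>2 * (hit_const * y / (4 * \<tau>))"
    using small by (intro add_left_mono mult_left_mono) auto
  also have "\<dots> = \<tau> * s\<^sup>2 * (hit_const * y) / 2"
  proof -
    have "C3 = \<tau> * (hit_const * y) / 4" using hy hit_const_pos y by (simp add: \<tau>_def)
    then show ?thesis using \<tau> by (simp add: power2_eq_square field_simps)
  qed
  finally have "2 * (\<tau> * s) * (\<Sum>n\<in>F. measure M (A n \<inter> (U - Y'))) \<le> \<tau> * s\<^sup>2 * (hit_const * y) / 2" .
  moreover have "2 * (\<tau> * s) * (hit_const * (y / 2) * s) \<le>
      2 * (\<tau> * s) * (\<Sum>n\<in>F. measure M (A n \<inter> (U - Y')))"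
    using order_trans[OF lower upper] \<tau> s by (intro mult_left_mono) auto
  moreover have "2 * (\<tau> * s) * (hit_const * (y / 2) * s) = \<tau> * s\<^sup>2 * (hit_const * y)"
    by (simp add: power2_eq_square)
  moreover have "\<tau> * s\<^sup>2 * (hit_const * y) > 0" using \<tau> s hy by simp
  ultimately show False by linarith
qed

end

section \<open>Extraction of the constants and the piecewise Lipschitz case\<close>

lemma mixing_expanding_systemI:
  fixes M :: "'a::metric_space measure"
  assumes "compact (UNIV :: 'a set)" "separable_space (euclidean :: 'a topology)"
    and "mpt_system M T" "open_pieces M T I P" "\<delta> > 0"
    and ahlfors: "ahlfors_regular M \<delta>" and mixing: "uniform_mixing M T"
    and distortion: "bounded_distortion T I P" and expanding: "expanding T I P \<delta>"
  obtains \<eta>1 \<eta>2 r0 K1 S a where "mixing_expanding_system M T I P \<delta> \<eta>1 \<eta>2 r0 K1 S a"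
proof -
  obtain \<eta>1 \<eta>2 r0 where A: "\<eta>1 > 0" "\<eta>2 > 0" "r0 > 0"
    "\<And>x r. 0 < r \<Longrightarrow> r < r0 \<Longrightarrow> \<eta>1 * r powr \<delta> \<le> measure M (ball x r)"
    "\<And>x r. 0 < r \<Longrightarrow> r < r0 \<Longrightarrow> measure M (ball x r) \<le> \<eta>2 * r powr \<delta>"
    using ahlfors unfolding ahlfors_regular_def by metis
  obtain a :: "nat \<Rightarrow> real" where a: "\<forall>n\<ge>1. a n > 0" "summable a"
    "\<forall>x r y s n. r > 0 \<and> s > 0 \<and> n \<ge> 1 \<longrightarrow>
      \<bar>measure M (ball x r \<inter> (T ^^ n) -` ball y s) - measure M (ball x r) * measure M (ball y s)\<bar>
        \<le> a n * measure M (ball y s)"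
    using mixing unfolding uniform_mixing_def by blast
  obtain K where K: "K > 0" "\<forall>m\<ge>1. \<forall>J\<in>cylinders T I P m. \<forall>x\<in>J. \<forall>y\<in>J. \<forall>z\<in>J. x \<noteq> y \<and> x \<noteq> z \<longrightarrow>
        (let q = (dist ((T ^^ m) x) ((T ^^ m) y) / dist x y) /
                 (dist ((T ^^ m) x) ((T ^^ m) z) / dist x z)
         in inverse K \<le> q \<and> q \<le> K)"
    using distortion unfolding bounded_distortion_def by blast
  let ?w = "\<lambda>m. \<Sum>\<^sub>\<infinity>J\<in>cylinders T I P m. neg_power (expansion T m J) \<delta>"
  have fin: "(SUP m\<in>{1..}. ?w m) < \<infinity>"
    and lim: "(\<lambda>m. INF J\<in>cylinders T I P m. expansion T m J) \<longlonglongrightarrow> \<infinity>"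
    using expanding by (auto simp: expanding_def)
  have S: "?w m \<le> ennreal (enn2real (SUP m\<in>{1..}. ?w m))" if "m \<ge> 1" for m
  proof -
    have "?w m \<le> (SUP m\<in>{1..}. ?w m)" using that by (intro SUP_upper) auto
    also have "\<dots> = ennreal (enn2real (SUP m\<in>{1..}. ?w m))" using fin by simp
    finally show ?thesis .
  qed
  have D: "dist ((T ^^ m) x) ((T ^^ m) y) / dist x y
      \<le> max 1 K * (dist ((T ^^ m) x) ((T ^^ m) z) / dist x z)"
    if "m \<ge> 1" "J \<in> cylinders T I P m" "x \<in> J" "y \<in> J" "z \<in> J" "x \<noteq> y" "x \<noteq> z" for m J x y z
  proof -
    let ?u = "dist ((T ^^ m) x) ((T ^^ m) y) / dist x y" and ?v = "dist ((T ^^ m) x) ((T ^^ m) z) / dist x z"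
    have q: "inverse K \<le> ?u / ?v" "?u / ?v \<le> K"
      using K(2)[unfolded Let_def, rule_format, OF that(1-5) conjI[OF that(6,7)]] by auto
    \<comment> \<open>Division by zero yields 0, so the positive lower distortion bound forces
      \<open>?v\<close> to be nonzero and the quotient can be multiplied out.\<close>
    have "?u / ?v > 0" using q(1) K(1) by (meson inverse_positive_iff_positive less_le_trans)
    then have "?v \<noteq> 0" by auto
    moreover have "?v \<ge> 0" by simp
    ultimately have v: "?v > 0" by linarith
    then have "?u \<le> K * ?v" using q(2) by (simp only: pos_divide_le_eq)
    also have "\<dots> \<le> max 1 K * ?v" using v by (intro mult_right_mono) auto
    finally show ?thesis .
  qed
  have a1: "a n > 0" if "n \<ge> 1" for n using a(1) that by simp
  have a3: "\<bar>measure M (ball x r \<inter> (T ^^ n) -` ball y s) - measure M (ball x r) * measure M (ball y s)\<bar>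
      \<le> a n * measure M (ball y s)" if "r > 0" "s > 0" "n \<ge> 1" for x r y s n
    using a(3) that by simp
  have max: "1 \<le> max 1 K" by simp
  have "mixing_expanding_system M T I P \<delta> \<eta>1 \<eta>2 r0 (max 1 K) (enn2real (SUP m\<in>{1..}. ?w m)) a"
    by (rule mixing_expanding_system.intro) (fact assms A a1 a(2) a3 max D lim S enn2real_nonneg)+
  then show ?thesis by (rule that)
qed

theorem theorem1p3:
  fixes M :: "'a::metric_space measure"
    and T f :: "'a \<Rightarrow> 'a"
    and I :: "'i set"
    and P :: "'i \<Rightarrow> 'a set"
    and \<delta> :: real
    and \<psi> :: "nat \<Rightarrow> real"
  assumes "compact (UNIV :: 'a set)"
    and "separable_space (euclidean :: 'a topology)"
    and "mpt_system M T"
    and "open_pieces M T I P"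
    and "\<delta> > 0"
    and "ahlfors_regular M \<delta>"
    and "uniform_mixing M T"
    and "bounded_distortion T I P"
    and "expanding T I P \<delta>"
    and "conformal T I P"
    and "\<And>n. n \<ge> 1 \<Longrightarrow> \<psi> n > 0"
    and "\<psi> \<longlonglongrightarrow> 0"
    and "piecewise_lipschitz M f"
  shows "recurrence_set T f \<psi> \<in> null_sets (completion M) \<longleftrightarrow>
         summable (\<lambda>n. \<psi> (Suc n) powr \<delta>)"
proof -
  obtain \<eta>1 \<eta>2 r0 K1 S a where "mixing_expanding_system M T I P \<delta> \<eta>1 \<eta>2 r0 K1 S a"
    using mixing_expanding_systemI[OF assms(1-9)] .
  then interpret mixing_expanding_system M T I P \<delta> \<eta>1 \<eta>2 r0 K1 S a .
  obtain A :: "nat set" and Y g where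
    Yg: "\<forall>i\<in>A. Y i \<in> sets M \<and> (\<exists>L. L-lipschitz_on UNIV (g i)) \<and> (\<forall>x\<in>Y i. f x = g i x)"
    and cover: "emeasure M (UNIV - (\<Union>i\<in>A. Y i)) = 0"
    using assms(13) unfolding piecewise_lipschitz_def by blast
  have Yb: "Y i \<in> sets M" if "i \<in> A" for i using bspec[OF Yg that] by simp
  have lip: "\<exists>L. L \<ge> 1 \<and> L-lipschitz_on UNIV (g i)" if "i \<in> A" for i
  proof -
    have "\<exists>L. L-lipschitz_on UNIV (g i)" using bspec[OF Yg that] by simp
    then obtain L where "L-lipschitz_on UNIV (g i)" ..
    then have "(max 1 L)-lipschitz_on UNIV (g i)" by (rule lipschitz_on_le) simp
    then show ?thesis by (intro exI[of _ "max 1 L"]) simp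
  qed
  \<comment> \<open>Membership of \<open>x\<close> depends on \<open>f\<close> only through the
    value \<open>f x\<close>.\<close>
  have rec: "x \<in> recurrence_set T f \<psi> \<longleftrightarrow> x \<in> recurrence_set T (g i) \<psi>" if "i \<in> A" "x \<in> Y i" for i x
    using Yg that by (simp add: recurrence_set_def)
  have UYb: "(\<Union>i\<in>A. Y i) \<in> sets M" using Yb by (intro sets.countable_UN') auto
  have sum_iff: "summable (\<lambda>n. \<psi> (Suc n) powr \<delta>) \<longleftrightarrow> summable (\<lambda>n. \<psi> n powr \<delta>)"
    by (rule summable_Suc_iff)
  show ?thesis
    unfolding sum_iff
  proof
    assume sum: "summable (\<lambda>n. \<psi> n powr \<delta>)"
    \<comment> \<open>A null set of \<open>M\<close> containing the recurrence set of
      \<open>f\<close>, which is what nullity in the completion means.\<close>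
    let ?N = "(UNIV - (\<Union>i\<in>A. Y i)) \<union> (\<Union>i\<in>A. recurrence_set T (g i) \<psi>)"
    have "recurrence_set T (g i) \<psi> \<in> null_sets M" if "i \<in> A" for i
      using lip[OF that] recurrence_set_null[OF _ _ assms(11,12) sum] by blast
    moreover have "UNIV - (\<Union>i\<in>A. Y i) \<in> null_sets M"
      using cover sets.compl_sets[OF UYb] by (auto simp: null_sets_def)
    ultimately have "?N \<in> null_sets M"
      by (intro null_sets.Un null_sets_UN') auto
    moreover have "recurrence_set T f \<psi> \<subseteq> ?N" using rec by blast
    ultimately show "recurrence_set T f \<psi> \<in> null_sets (completion M)"
      unfolding null_sets_completion_iff2 by blast
  next
    assume "recurrence_set T f \<psi> \<in> null_sets (completion M)"
    then obtain N where N: "N \<in> null_sets M" "recurrence_set T f \<psi> \<subseteq> N"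
      unfolding null_sets_completion_iff2 by blast
    show "summable (\<lambda>n. \<psi> n powr \<delta>)"
    proof (rule ccontr)
      assume div: "\<not> summable (\<lambda>n. \<psi> n powr \<delta>)"
      \<comment> \<open>Countably many null pieces could not cover almost all of a probability
        space.\<close>
      have "\<exists>i\<in>A. measure M (Y i) > 0"
      proof (rule ccontr)
        assume "\<not> (\<exists>i\<in>A. measure M (Y i) > 0)"
        then have "Y i \<in> null_sets M" if "i \<in> A" for i
          using Yb[OF that] that by (auto simp: null_sets_def emeasure_eq_measure zero_less_measure_iff)
        then have "(\<Union>i\<in>A. Y i) \<in> null_sets M" by (intro null_sets_UN') auto
        moreover have "UNIV - (\<Union>i\<in>A. Y i) \<in> null_sets M"
          using cover sets.compl_sets[OF UYb] by (auto simp: null_sets_def)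
        ultimately have "(\<Union>i\<in>A. Y i) \<union> (UNIV - (\<Union>i\<in>A. Y i)) \<in> null_sets M" by (rule null_sets.Un)
        then have "space M \<in> null_sets M" by simp
        then show False using emeasure_space_1 by (auto simp: null_sets_def)
      qed
      then obtain i where i: "i \<in> A" "measure M (Y i) > 0" by blast
      obtain L where L: "L \<ge> 1" "L-lipschitz_on UNIV (g i)" using lip[OF i(1)] by blast
      \<comment> \<open>On \<open>Y i\<close> the set for \<open>f\<close> agrees with the one for
        \<open>g i\<close>, which is Borel; the trace has positive measure yet lies in the null set
        \<open>N\<close>.\<close>
      have "measure M (Y i \<inter> recurrence_set T (g i) \<psi>) > 0"
        using recurrence_set_meets[OF L(2,1) assms(11,12) div _ i(2)] Yb[OF i(1)] by simp
      moreover have "Y i \<inter> recurrence_set T (g i) \<psi> \<in> null_sets M"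
      proof (rule null_sets_subset[OF N(1)])
        show "Y i \<inter> recurrence_set T (g i) \<psi> \<in> sets M"
          using Yb[OF i(1)] recurrence_set_borel[OF L(2)] by (intro sets.Int) simp_all
        show "Y i \<inter> recurrence_set T (g i) \<psi> \<subseteq> N" using rec[OF i(1)] N(2) by blast
      qed
      ultimately show False by (simp add: null_sets_def measure_def)
    qed
  qed
qed

end
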